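(* Let $(X_i)_{i\ge1}$ be i.i.d. real-valued random variables with $\mathbb{E}[X_1]=-\gamma<0$ and $\mathbb{P}(X_1\ge x)=L(x)x^{-\beta}$, where $\beta>1$ and $L$ is slowly varying at infinity. Let $W_0=0$, $W_n=X_1+\cdots+X_n$ for $n\ge1$, and $\zeta=\inf\{i\ge1:W_i<0\}$. Let $(W^{(n)}_i:i\ge0)$ be distributed as the random walk $(W_i:i\ge0)$ under the conditional probability $\mathbb{P}(\,\cdot\mid\zeta\ge n)$, and let $(Z^{(n)}_i:i\ge0)$ be the process defined in the context. Then $$d_{\mathrm{TV}}\left((W^{(n)}_i:i\ge0),\,(Z^{(n)}_i:i\ge0)\right)\xrightarrow[n\to\infty]{}0,$$ where $d_{\mathrm{TV}}$ denotes the total variation distance (between laws) on $\mathbb{R}^{\mathbb{Z}_+}$ equipped with the product topology.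
   Context: $L$ is slowly varying at infinity if $L(\lambda x)/L(x)\to1$ as $x\to\infty$ for every $\lambda>0$. One has $\mathbb{E}[\zeta]<\infty$. The law of the process $(Z^{(n)}_i:i\ge0)$ is specified as follows. Let $I$ be a random variable with $\mathbb{P}(I=j)=\mathbb{P}(\zeta\ge j)/\mathbb{E}[\zeta]$ for $j\ge1$. For every $j\ge1$, conditionally given $\{I=j\}$, the three random variables $(Z^{(n)}_i:0\le i<j)$, $Y^{(n)}_j:=Z^{(n)}_j-Z^{(n)}_{j-1}$ and $(Z^{(n)}_{i+j}-Z^{(n)}_j:i\ge0)$ are independent, with: $(Z^{(n)}_i:0\le i<j)$ distributed as $(W_i:0\le i<j)$ under $\mathbb{P}(\,\cdot\mid\zeta\ge j)$; $Y^{(n)}_j$ distributed as $X_1$ under $\mathbb{P}(\,\cdot\mid X_1\ge\gamma n)$; and $(Z^{(n)}_{i+j}-Z^{(n)}_j:i\ge0)$ distributed as $(W_i:i\ge0)$. *)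

theory Defs
  imports "HOL-Probability.Probability"
begin

definition slowly_varying :: "(real \<Rightarrow> real) \<Rightarrow> bool" where
  "slowly_varying L \<longleftrightarrow> (\<forall>c>0. ((\<lambda>x. L (c * x) / L x) \<longlongrightarrow> 1) at_top)"

text \<open>The steps are \<open>X 1, X 2, \<dots>\<close>; the value \<open>X 0\<close> is never used.\<close>

definition walk :: "(nat \<Rightarrow> 'a \<Rightarrow> real) \<Rightarrow> nat \<Rightarrow> 'a \<Rightarrow> real" where
  "walk X n \<omega> = (\<Sum>i = 1..n. X i \<omega>)"

text \<open>The infimum is taken in \<^typ>\<open>enat\<close>, so it is \<open>\<infinity>\<close> if the walk never becomes negative.\<close>

definition zeta :: "(nat \<Rightarrow> 'a \<Rightarrow> real) \<Rightarrow> 'a \<Rightarrow> enat" where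
  "zeta X \<omega> = Inf (enat ` {i. 1 \<le> i \<and> walk X i \<omega> < 0})"

definition expected_zeta :: "'a measure \<Rightarrow> (nat \<Rightarrow> 'a \<Rightarrow> real) \<Rightarrow> ennreal" where
  "expected_zeta M X = (\<integral>\<^sup>+ \<omega>. ennreal_of_enat (zeta X \<omega>) \<partial>M)"

text \<open>Throughout, \<open>uniform_measure M A\<close> is the conditional probability \<open>M(\<cdot> | A)\<close>.
  For infinite paths, \<open>borel\<close> on \<^typ>\<open>nat \<Rightarrow> real\<close> is the Borel sigma-algebra of the product
  topology; by \<open>sets_PiM_equal_borel\<close> it is also the product sigma-algebra.\<close>

definition path_law :: "'a measure \<Rightarrow> (nat \<Rightarrow> 'a \<Rightarrow> real) \<Rightarrow> (nat \<Rightarrow> real) measure" where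
  "path_law M Y = distr M borel (\<lambda>\<omega> i. Y i \<omega>)"

definition prefix_law :: "'a measure \<Rightarrow> (nat \<Rightarrow> 'a \<Rightarrow> real) \<Rightarrow> nat \<Rightarrow> (nat \<Rightarrow> real) measure" where
  "prefix_law M Y j = distr M (PiM {..<j} (\<lambda>_. borel)) (\<lambda>\<omega>. \<lambda>i\<in>{..<j}. Y i \<omega>)"

definition sigma_of :: "'a measure \<Rightarrow> ('a \<Rightarrow> 'b) \<Rightarrow> 'b measure \<Rightarrow> 'a set set" where
  "sigma_of M f K = sets (vimage_algebra (space M) f K)"

text \<open>Independence of three random variables with possibly different value types, which
  \<open>prob_space.indep_vars\<close> does not allow: independence of the generated sigma-algebras.\<close>

definition indep_three ::
  "'a measure \<Rightarrow> 'b measure \<Rightarrow> ('a \<Rightarrow> 'b) \<Rightarrow> 'c measure \<Rightarrow> ('a \<Rightarrow> 'c) \<Rightarrow> 'd measure \<Rightarrow> ('a \<Rightarrow> 'd) \<Rightarrow> bool"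
  where
  "indep_three M K1 f1 K2 f2 K3 f3 \<longleftrightarrow>
     f1 \<in> measurable M K1 \<and> f2 \<in> measurable M K2 \<and> f3 \<in> measurable M K3 \<and>
     prob_space.indep_sets M
       (\<lambda>k. [sigma_of M f1 K1, sigma_of M f2 K2, sigma_of M f3 K3] ! k) {0, 1, 2 :: nat}"

text \<open>\<open>big_jump_process M X g n N I Z\<close>: the random variable \<open>I\<close> and the process \<open>Z\<close>, living on the
  probability space \<open>N\<close>, realise the single-big-jump description, where \<open>M\<close> carries the
  steps \<open>X\<close> and \<open>g\<close> is minus their mean. This determines the law of \<open>Z\<close>.\<close>

definition big_jump_process ::
  "'a measure \<Rightarrow> (nat \<Rightarrow> 'a \<Rightarrow> real) \<Rightarrow> real \<Rightarrow> nat \<Rightarrow>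
   'b measure \<Rightarrow> ('b \<Rightarrow> nat) \<Rightarrow> (nat \<Rightarrow> 'b \<Rightarrow> real) \<Rightarrow> bool" where
  "big_jump_process M X g n N I Z \<longleftrightarrow>
     prob_space N \<and>
     I \<in> measurable N (count_space UNIV) \<and>
     (\<forall>i. Z i \<in> borel_measurable N) \<and>
     (\<forall>j\<ge>1. measure N {\<omega> \<in> space N. I \<omega> = j} =
        measure M {\<omega> \<in> space M. zeta X \<omega> \<ge> enat j} / enn2real (expected_zeta M X)) \<and>
     (\<forall>j\<ge>1.
       let Nj = uniform_measure N {\<omega> \<in> space N. I \<omega> = j};
           pre = (\<lambda>\<omega>. \<lambda>i\<in>{..<j}. Z i \<omega>);
           jump = (\<lambda>\<omega>. Z j \<omega> - Z (j - 1) \<omega>);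
           post = (\<lambda>\<omega> i. Z (i + j) \<omega> - Z j \<omega>)
       in indep_three Nj (PiM {..<j} (\<lambda>_. borel)) pre borel jump borel post \<and>
          prefix_law Nj Z j
            = prefix_law (uniform_measure M {\<omega> \<in> space M. zeta X \<omega> \<ge> enat j}) (walk X) j \<and>
          distr Nj borel jump
            = distr (uniform_measure M {\<omega> \<in> space M. X 1 \<omega> \<ge> g * real n}) borel (X 1) \<and>
          path_law Nj (\<lambda>i \<omega>. Z (i + j) \<omega> - Z j \<omega>) = path_law M (walk X))"

text \<open>Total variation distance, meant for probability measures on the same sigma-algebra.\<close>

definition tv_dist :: "'a measure \<Rightarrow> 'a measure \<Rightarrow> real" where
  "tv_dist P Q = (SUP A\<in>sets P. \<bar>measure P A - measure Q A\<bar>)"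

end

theory Submission
  imports Defs "HOL-Real_Asymp.Real_Asymp"
begin

text \<open>
  Write \<open>p n = P(X 1 \<ge> \<gamma> n)\<close> and \<open>J n j = {\<zeta> \<ge> j, X j \<ge> \<gamma> n}\<close>. Independence of past, jump and future
  shows that the law of \<open>Z\<close> is \<open>A \<mapsto> (\<Sum>j. P(W \<in> A, J n j)) / (E \<zeta> p n)\<close>, so only this mixture has to be
  compared with \<open>P(W \<in> A, \<zeta> \<ge> n) / P(\<zeta> \<ge> n)\<close>, and it is enough to bound the former by the latter,
  uniformly in \<open>A\<close>. For fixed \<open>j\<close> the event \<open>J n j\<close> is, up to \<open>o(p n)\<close>, contained in \<open>{\<zeta> \<ge> n}\<close>: a jump
  exceeding \<open>(1 + \<delta>) \<gamma> n\<close> keeps the walk nonnegative until \<open>n\<close> by the law of large numbers, and regular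
  variation controls the jumps in between. Two jumps cost \<open>(p n)\<^sup>2\<close>. It remains to see that
  \<open>P(\<zeta> \<ge> n) \<le> (E \<zeta> + o(1)) p n\<close>. Paths without a jump above \<open>\<eta> n\<close> have probability \<open>o(p n)\<close> by a
  Chernoff bound with exponential parameter of order \<open>ln n / n\<close>; a jump above \<open>\<eta> n\<close> at a time \<open>i > J\<close> has
  probability at most a constant times \<open>p n\<close> times the tail of the convergent series \<open>\<Sum>i. P(\<zeta> \<ge> i)\<close>; and a
  jump at a time \<open>i \<le> J\<close> must exceed \<open>(1 - \<delta>) \<gamma> n\<close>, again by the law of large numbers.
\<close>

subsection \<open>Regularly varying tails\<close>

declare One_nat_def [simp del] \<comment> \<open>otherwise the step \<open>X 1\<close> is rewritten to \<open>X (Suc 0)\<close>\<close>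

text \<open>Transfers estimates along the points \<open>2 ^ k * x0\<close> to every
  \<open>x\<close>: a monotone function is squeezed between its values at two consecutive points of
  this kind.\<close>

lemma dyadic_scale:
  fixes x0 x :: real
  assumes "0 < x0" "x0 \<le> x"
  obtains k :: nat where "2 ^ k * x0 \<le> x" "x < 2 ^ Suc k * x0"
proof -
  define k where "k = nat \<lfloor>log 2 (x / x0)\<rfloor>"
  have l: "0 \<le> log 2 (x / x0)" using assms by simp
  have k: "real k \<le> log 2 (x / x0)" "log 2 (x / x0) < real (Suc k)"
    using l unfolding k_def by linarith+
  have xx: "0 < x / x0" using assms by simp
  have "2 powr real k \<le> x / x0" using k(1) xx by (simp add: le_log_iff)
  moreover have "x / x0 < 2 powr real (Suc k)" using k(2) xx by (simp add: log_less_iff)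
  ultimately show ?thesis
    using that[of k] assms(1) by (simp add: powr_realpow field_simps powr_add)
qed

text \<open>Purely analytic setting for the tail of a step. Monotonicity is what carries bounds from
  dyadic points to all arguments, so slow variation is needed only pointwise in the scaling
  factor.\<close>

locale regularly_varying_tail =
  fixes p L :: "real \<Rightarrow> real" and \<beta> :: real
  assumes slow: "slowly_varying L"
    and tail_eq: "x > 0 \<Longrightarrow> p x = L x * x powr (- \<beta>)"
    and tail_nonneg: "0 \<le> p x"
    and tail_antimono: "x \<le> y \<Longrightarrow> p y \<le> p x"
begin

lemma tail_ratio:
  assumes c: "c > 0"
  shows "((\<lambda>x. p (c * x) / p x) \<longlongrightarrow> c powr (- \<beta>)) at_top"
proof -
  have "((\<lambda>x. L (c * x) / L x * c powr (- \<beta>)) \<longlongrightarrow> 1 * c powr (- \<beta>)) at_top"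
    using slow c unfolding slowly_varying_def by (intro tendsto_mult) auto
  moreover have "\<forall>\<^sub>F x in at_top. L (c * x) / L x * c powr (- \<beta>) = p (c * x) / p x"
    using eventually_gt_at_top[of 0]
  proof eventually_elim
    case (elim x)
    then show ?case
      using c by (simp add: tail_eq powr_mult)
  qed
  ultimately show ?thesis
    by (auto intro: Lim_transform_eventually)
qed

text \<open>Division by zero yields \<open>0\<close>, so the limit for the factor \<open>1\<close>
  forces \<open>L y\<close> to be nonzero for large \<open>y\<close>. Monotonicity then carries
  positivity back to every \<open>x\<close>, nonpositive ones included.\<close>

lemma tail_pos: "0 < p x"
proof -
  have "((\<lambda>x. L (1 * x) / L x) \<longlongrightarrow> 1) at_top"
    using slow zero_less_one unfolding slowly_varying_def by blast
  then have "\<forall>\<^sub>F x in at_top. L (1 * x) / L x > 1 / 2"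
    by (intro order_tendstoD) auto
  then have "\<forall>\<^sub>F y in at_top. L (1 * y) / L y > 1 / 2 \<and> y > 0 \<and> y \<ge> x"
    by (intro eventually_conj eventually_gt_at_top eventually_ge_at_top)
  then obtain y where y: "L y / L y > 1 / 2" "y > 0" "y \<ge> x"
    by (auto simp: eventually_at_top_linorder)
  then have "p y \<noteq> 0" by (auto simp: tail_eq)
  with tail_nonneg[of y] tail_antimono[OF y(3)] show ?thesis by linarith
qed

lemma tail_ratio_seq:
  assumes "c > 0" "d > 0"
  shows "(\<lambda>n. p (c * real n) / p (d * real n)) \<longlonglongrightarrow> (c / d) powr (- \<beta>)"
proof -
  have "filterlim (\<lambda>n. d * real n) at_top sequentially"
    using assms by real_asymp
  from filterlim_compose[OF tail_ratio[of "c / d"] this] assms show ?thesis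
    by simp
qed

text \<open>One half of Potter's bounds. Because \<open>b < \<beta>\<close>, doubling a large
  argument multiplies \<open>p\<close> by at most \<open>2 powr (- b)\<close>; iterating this along
  dyadic points gives a power bound.\<close>

lemma tail_upper:
  assumes b: "0 < b" "b < \<beta>"
  obtains C x0 where "C > 0" "x0 > 0" "\<And>x. x \<ge> x0 \<Longrightarrow> p x \<le> C * x powr (- b)"
proof -
  have "\<forall>\<^sub>F x in at_top. p (2 * x) / p x < 2 powr (- b)"
    using tail_ratio[of 2] b by (intro order_tendstoD) auto
  then obtain x1 where x1: "\<And>x. x \<ge> x1 \<Longrightarrow> p (2 * x) / p x < 2 powr (- b)"
    by (auto simp: eventually_at_top_linorder)
  define x0 where "x0 = max x1 1"
  have x0: "x0 > 0" "x0 \<ge> x1" by (auto simp: x0_def)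
  have it: "p (2 ^ k * x0) \<le> (2 powr (- b)) ^ k * p x0" for k
  proof (induction k)
    case (Suc k)
    have "x0 \<le> 2 ^ k * x0"
      using x0 by simp
    then have "2 ^ k * x0 \<ge> x1"
      using x0 by linarith
    from x1[OF this] have "p (2 * (2 ^ k * x0)) \<le> 2 powr (- b) * p (2 ^ k * x0)"
      using tail_pos by (simp add: divide_less_eq less_imp_le)
    also have "\<dots> \<le> 2 powr (- b) * ((2 powr (- b)) ^ k * p x0)"
      using Suc by (intro mult_left_mono) auto
    finally show ?case by (simp add: mult.assoc)
  qed simp
  show ?thesis
  proof
    \<comment> \<open>The factor \<open>(2 * x0) powr b\<close> normalises by \<open>x0\<close> and
      pays for rounding \<open>x\<close> down to \<open>2 ^ k * x0\<close>, which changes it by a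
      factor below 2.\<close>
    show "p x0 * (2 * x0) powr b > 0" "x0 > 0" using x0 tail_pos by auto
    fix x assume x: "x \<ge> x0"
    obtain k where k: "2 ^ k * x0 \<le> x" "x < 2 ^ Suc k * x0"
      using dyadic_scale[OF x0(1) x] .
    have "p x \<le> p (2 ^ k * x0)" by (rule tail_antimono) fact
    also have "\<dots> \<le> (2 powr (- b)) ^ k * p x0" by (rule it)
    also have "(2 powr (- b)) ^ k = (2 ^ k) powr (- b)"
      by (simp add: powr_powr powr_realpow[symmetric] mult.commute)
    also have "\<dots> \<le> (x / (2 * x0)) powr (- b)"
      using k x0 x b by (intro powr_mono2') (auto simp: field_simps)
    also have "\<dots> = (2 * x0) powr b * x powr (- b)"
      using x0 x by (simp add: powr_divide powr_minus field_simps)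
    finally show "p x \<le> p x0 * (2 * x0) powr b * x powr (- b)"
      using tail_pos[of x0] by (simp add: mult_ac)
  qed
qed

text \<open>The other half of Potter's bounds, with \<open>x\<close> rounded up to the next dyadic
  point.\<close>

lemma tail_lower:
  assumes b: "0 < b" "\<beta> < b"
  obtains C x0 where "C > 0" "x0 > 0" "\<And>x. x \<ge> x0 \<Longrightarrow> C * x powr (- b) \<le> p x"
proof -
  have "\<forall>\<^sub>F x in at_top. p (2 * x) / p x > 2 powr (- b)"
    using tail_ratio[of 2] b by (intro order_tendstoD) auto
  then obtain x1 where x1: "\<And>x. x \<ge> x1 \<Longrightarrow> p (2 * x) / p x > 2 powr (- b)"
    by (auto simp: eventually_at_top_linorder)
  define x0 where "x0 = max x1 1"
  have x0: "x0 > 0" "x0 \<ge> x1" by (auto simp: x0_def)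
  have it: "(2 powr (- b)) ^ k * p x0 \<le> p (2 ^ k * x0)" for k
  proof (induction k)
    case (Suc k)
    have "x0 \<le> 2 ^ k * x0"
      using x0 by simp
    then have "2 ^ k * x0 \<ge> x1"
      using x0 by linarith
    from x1[OF this] have *: "2 powr (- b) * p (2 ^ k * x0) \<le> p (2 * (2 ^ k * x0))"
      using tail_pos by (simp add: less_divide_eq less_imp_le)
    have "2 powr (- b) * ((2 powr (- b)) ^ k * p x0) \<le> 2 powr (- b) * p (2 ^ k * x0)"
      using Suc by (intro mult_left_mono) auto
    also note *
    finally show ?case by (simp add: mult.assoc)
  qed simp
  show ?thesis
  proof
    show "p x0 * (2 / x0) powr (- b) > 0" "x0 > 0" using x0 tail_pos by auto
    fix x assume x: "x \<ge> x0"
    obtain k where k: "2 ^ k * x0 \<le> x" "x < 2 ^ Suc k * x0"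
      using dyadic_scale[OF x0(1) x] .
    have "(2 * x / x0) powr (- b) \<le> (2 ^ Suc k) powr (- b)"
      using k x0 x b by (intro powr_mono2') (auto simp: field_simps)
    also have "(2 ^ m) powr (- b) = (2 powr (- b)) ^ m" for m
      by (simp add: powr_powr powr_realpow[symmetric] mult.commute)
    finally have "p x0 * (2 * x / x0) powr (- b) \<le> p x0 * (2 powr (- b)) ^ Suc k"
      using tail_nonneg[of x0] by (rule mult_left_mono)
    also have "\<dots> \<le> p (2 ^ Suc k * x0)" using it[of "Suc k"] by (simp add: mult_ac)
    also have "\<dots> \<le> p x" using k by (intro tail_antimono) auto
    also have "(2 * x / x0) powr (- b) = (2 / x0) powr (- b) * x powr (- b)"
      using x0 x powr_mult[of "2 / x0" x "- b"] by simp
    finally show "p x0 * (2 / x0) powr (- b) * x powr (- b) \<le> p x"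
      by (simp add: mult_ac)
  qed
qed

end

subsection \<open>Random walks with negative drift\<close>

text \<open>Only times strictly below \<open>n\<close> occur, so survival up to \<open>n\<close> is
  decided by the first \<open>n - 1\<close> steps. This off-by-one makes \<open>surv n\<close>
  independent of \<open>X n\<close>.\<close>

lemma zeta_ge_iff: "enat n \<le> zeta X \<omega> \<longleftrightarrow> (\<forall>k\<in>{1..<n}. 0 \<le> walk X k \<omega>)"
proof -
  have "enat n \<le> zeta X \<omega> \<longleftrightarrow> (\<forall>k. 1 \<le> k \<and> walk X k \<omega> < 0 \<longrightarrow> n \<le> k)"
    unfolding zeta_def by (auto simp: le_Inf_iff)
  also have "\<dots> \<longleftrightarrow> (\<forall>k\<in>{1..<n}. 0 \<le> walk X k \<omega>)"
    by (meson atLeastLessThan_iff leI linorder_not_less)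
  finally show ?thesis .
qed

locale drift_walk = prob_space M
  for M :: "'a measure" +
  fixes X :: "nat \<Rightarrow> 'a \<Rightarrow> real" and L :: "real \<Rightarrow> real" and \<gamma> \<beta> :: real
  assumes indep: "indep_vars (\<lambda>_. borel) X {1..}"
    and ident: "i \<ge> 1 \<Longrightarrow> distr M borel (X i) = distr M borel (X 1)"
    and integrable_step: "integrable M (X 1)"
    and mean_step: "expectation (X 1) = - \<gamma>"
    and drift: "\<gamma> > 0"
    and index: "\<beta> > 1"
    and slowly: "slowly_varying L"
    and tail_form: "x > 0 \<Longrightarrow> prob {\<omega> \<in> space M. X 1 \<omega> \<ge> x} = L x * x powr (- \<beta>)"
begin

definition tail :: "real \<Rightarrow> real" where
  "tail x = prob {\<omega> \<in> space M. x \<le> X 1 \<omega>}"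

definition surv :: "nat \<Rightarrow> 'a set" where
  "surv n = {\<omega> \<in> space M. enat n \<le> zeta X \<omega>}"

lemma surv_eq: "surv n = {\<omega> \<in> space M. \<forall>k\<in>{1..<n}. 0 \<le> walk X k \<omega>}"
  by (simp add: surv_def zeta_ge_iff)

lemma step_measurable: "1 \<le> i \<Longrightarrow> X i \<in> borel_measurable M"
  using indep unfolding indep_vars_def by auto

lemma step1_measurable [measurable]: "X 1 \<in> borel_measurable M"
  by (rule step_measurable) simp

lemma walk_measurable [measurable]: "walk X n \<in> borel_measurable M"
  unfolding walk_def by (auto intro!: borel_measurable_sum step_measurable)

lemma surv_measurable [measurable]: "surv n \<in> events"
  unfolding surv_eq by measurable

lemma surv_antimono: "m \<le> n \<Longrightarrow> surv n \<subseteq> surv m"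
  by (auto simp: surv_eq)

sublocale tail: regularly_varying_tail tail L \<beta>
proof
  show "tail y \<le> tail x" if "x \<le> y" for x y
    unfolding tail_def using that by (intro finite_measure_mono) auto
qed (use tail_form in \<open>auto simp: slowly tail_def\<close>)

section \<open>Independence of one step from all the others\<close>

lemma prob_step:
  assumes "1 \<le> i" "B \<in> sets borel"
  shows "prob {\<omega> \<in> space M. X i \<omega> \<in> B} = prob {\<omega> \<in> space M. X 1 \<omega> \<in> B}"
proof -
  have "measure (distr M borel (X i)) B = measure (distr M borel (X 1)) B"
    using ident[OF assms(1)] by simp
  then show ?thesis
    using assms step_measurable[of i] step_measurable[of 1]
    by (simp add: measure_distr vimage_def Int_def conj_commute)
qed

lemma tail_step: "1 \<le> i \<Longrightarrow> prob {\<omega> \<in> space M. x \<le> X i \<omega>} = tail x"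
  using prob_step[of i "{x..}"] by (simp add: tail_def)

text \<open>The sigma-algebra generated by all steps except the \<open>i\<close>-th, packaged as a
  measure so that measurability statements can refer to it directly.\<close>

definition others :: "nat \<Rightarrow> 'a measure" where
  "others i = vimage_algebra (space M) (\<lambda>\<omega>. \<lambda>k\<in>{1..} - {i}. X k \<omega>) (PiM ({1..} - {i}) (\<lambda>_. borel))"

lemma space_others [simp]: "space (others i) = space M"
  by (simp add: others_def)

lemma step_others:
  assumes "1 \<le> k" "k \<noteq> i"
  shows "X k \<in> borel_measurable (others i)"
proof -
  have "(\<lambda>\<omega>. \<lambda>k\<in>{1..} - {i}. X k \<omega>) \<in> measurable (others i) (PiM ({1..} - {i}) (\<lambda>_. borel))"
    unfolding others_def by (rule measurable_vimage_algebra1) (auto simp: space_PiM)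
  then have "(\<lambda>\<omega>. (\<lambda>k\<in>{1..} - {i}. X k \<omega>) k) \<in> borel_measurable (others i)"
    by (rule measurable_component_singleton[THEN measurable_compose_rev, rotated]) (use assms in auto)
  then show ?thesis using assms by simp
qed

lemma step_others_measurable:
  "(\<lambda>\<omega>. \<lambda>k\<in>{1..} - {i}. X k \<omega>) \<in> measurable M (PiM ({1..} - {i}) (\<lambda>_. borel))"
  by (rule measurable_restrict) (auto intro: step_measurable)

lemma others_subset: "sets (others i) \<subseteq> events"
  unfolding others_def using step_others_measurable by (rule sets_image_in_sets[OF refl])

text \<open>Splitting the index set into \<open>{i}\<close> and its complement gives two independent
  blocks, and \<open>E\<close> is a preimage under the second block. All later factorisations over a
  single jump come from here.\<close>

lemma indep_others:
  assumes i: "1 \<le> i" and E: "E \<in> sets (others i)" and B: "B \<in> sets borel"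
  shows "prob (E \<inter> {\<omega> \<in> space M. X i \<omega> \<in> B}) = prob E * prob {\<omega> \<in> space M. X 1 \<omega> \<in> B}"
proof -
  let ?Y = "\<lambda>\<omega>. \<lambda>k\<in>{1..} - {i}. X k \<omega>" and ?K = "PiM ({1..} - {i}) (\<lambda>_. borel :: real measure)"
  obtain A where A: "A \<in> sets ?K" "E = ?Y -` A \<inter> space M"
    using E unfolding others_def by (auto simp: sets_vimage_algebra2 space_PiM)
  let ?B = "(\<lambda>x. x i) -` B \<inter> space (PiM {i} (\<lambda>_. borel :: real measure))"
  have B': "?B \<in> sets (PiM {i} (\<lambda>_. borel))"
    by (rule measurable_sets[OF _ B]) (rule measurable_component_singleton, simp)
  have "indep_var ?K ?Y (PiM {i} (\<lambda>_. borel)) (\<lambda>\<omega>. \<lambda>k\<in>{i}. X k \<omega>)"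
    by (rule indep_var_restrict[OF indep]) (use i in auto)
  from indep_varD[OF this A(1) B'] 
  have "prob (E \<inter> {\<omega> \<in> space M. X i \<omega> \<in> B}) = prob E * prob {\<omega> \<in> space M. X i \<omega> \<in> B}"
    by (auto simp: A(2) space_PiM vimage_def Int_def conj_ac cong: conj_cong)
  then show ?thesis using prob_step[OF i B] by simp
qed

lemma surv_others: "surv i \<in> sets (others i)"
proof -
  have [measurable]: "walk X k \<in> borel_measurable (others i)" if "k < i" for k
    unfolding walk_def using that by (auto intro!: borel_measurable_sum step_others)
  have "{\<omega> \<in> space (others i). 0 \<le> walk X k \<omega>} \<in> sets (others i)" if "k < i" for k
    using that by measurable
  then have "{\<omega> \<in> space (others i). \<forall>k\<in>{1..<i}. 0 \<le> walk X k \<omega>} \<in> sets (others i)"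
    by (intro sets.sets_Collect_finite_All) (simp_all del: space_others)
  then show ?thesis by (simp add: surv_eq)
qed

lemma prob_surv_jump:
  assumes "1 \<le> i"
  shows "prob (surv i \<inter> {\<omega> \<in> space M. x \<le> X i \<omega>}) = prob (surv i) * tail x"
  using indep_others[OF assms surv_others, of "{x..}"] by (simp add: tail_def)

lemma prob_two_jumps:
  assumes "1 \<le> i" "1 \<le> j" "i \<noteq> j"
  shows "prob ({\<omega> \<in> space M. x \<le> X i \<omega>} \<inter> {\<omega> \<in> space M. x \<le> X j \<omega>}) = (tail x)\<^sup>2"
proof -
  have "{\<omega> \<in> space (others j). x \<le> X i \<omega>} \<in> sets (others j)"
    using step_others[OF assms(1,3)] by measurable
  from indep_others[OF assms(2) this, of "{x..}"] show ?thesis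
    using tail_step[OF assms(1)] by (simp add: tail_def power2_eq_square)
qed

text \<open>If the first \<open>n - 1\<close> steps are all nonnegative the walk survives, and this
  has probability \<open>tail 0 ^ (n - 1)\<close>, which is positive. It makes conditioning on
  survival meaningful.\<close>

lemma surv_pos: "prob (surv n) > 0"
proof -
  have "indep_vars (\<lambda>_. borel) X {1..<n}"
    by (rule indep_vars_subset[OF indep]) auto
  then have *: "prob (\<Inter>i\<in>{1..<n}. X i -` {0..} \<inter> space M) = (\<Prod>i\<in>{1..<n}. prob (X i -` {0..} \<inter> space M))"
    if "1 < n" using that by (intro indep_varsD) auto
  have **: "prob (X i -` {0..} \<inter> space M) = tail 0" if "1 \<le> i" for i
    using tail_step[OF that, of 0] by (simp add: vimage_def Int_def conj_commute)
  show ?thesis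
  \<comment> \<open>The product rule is applied to a nonempty index set; for
    \<open>n \<le> 1\<close> survival is certain.\<close>
  proof (cases "1 < n")
    case True
    have "0 < (\<Prod>i\<in>{1..<n}. tail 0)"
      by (intro prod_pos) (auto simp: tail.tail_pos)
    also have "\<dots> = prob (\<Inter>i\<in>{1..<n}. X i -` {0..} \<inter> space M)"
      using * ** True by simp
    also have "\<dots> \<le> prob (surv n)"
      using True by (intro finite_measure_mono surv_measurable) (auto simp: surv_eq walk_def intro!: sum_nonneg)
    finally show ?thesis .
  next
    case False
    then have "surv n = space M" by (auto simp: surv_eq)
    then show ?thesis by (simp add: prob_space)
  qed
qed

end

subsection \<open>A maximal law of large numbers\<close>

context drift_walk
begin

text \<open>The part of \<open>x\<close> removed by truncation at level \<open>T\<close>; the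
  truncated value is \<open>x - big T x\<close>, which lies in \<open>[-T, T]\<close>.\<close>

definition big :: "real \<Rightarrow> real \<Rightarrow> real" where
  "big T x = (if \<bar>x\<bar> \<le> T then 0 else x)"

lemma big_measurable [measurable]: "big T \<in> borel_measurable borel"
  unfolding big_def by measurable

lemma expectation_step:
  assumes "1 \<le> i" and [measurable]: "f \<in> borel_measurable borel"
  shows "expectation (\<lambda>\<omega>. f (X i \<omega>)) = (expectation (\<lambda>\<omega>. f (X 1 \<omega>)) :: real)"
  using integral_distr[OF step_measurable[OF assms(1)], of f] integral_distr[OF step_measurable[of 1], of f]
    ident[OF assms(1)] by simp

lemma integrable_step_fun:
  fixes f :: "real \<Rightarrow> real"
  assumes "1 \<le> i" and [measurable]: "f \<in> borel_measurable borel"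
    and "integrable M (\<lambda>\<omega>. f (X 1 \<omega>))"
  shows "integrable M (\<lambda>\<omega>. f (X i \<omega>))"
  using integrable_distr_eq[OF step_measurable[OF assms(1)], of f]
    integrable_distr_eq[OF step_measurable[of 1], of f] ident[OF assms(1)] assms(3) by simp

lemma big_integrable: "1 \<le> i \<Longrightarrow> integrable M (\<lambda>\<omega>. big T (X i \<omega>))"
  by (rule integrable_step_fun)
     (auto simp: big_def intro!: Bochner_Integration.integrable_bound[OF integrable_step])

text \<open>Dominated convergence: at each sample point the removed part vanishes once the level
  exceeds the value of the step.\<close>

lemma big_expectation_tendsto: "(\<lambda>n. expectation (\<lambda>\<omega>. \<bar>big (real n) (X 1 \<omega>)\<bar>)) \<longlonglongrightarrow> 0"
proof -
  have "(\<lambda>n. expectation (\<lambda>\<omega>. \<bar>big (real n) (X 1 \<omega>)\<bar>)) \<longlonglongrightarrow> expectation (\<lambda>\<omega>. 0)"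
  proof (rule integral_dominated_convergence[where w = "\<lambda>\<omega>. \<bar>X 1 \<omega>\<bar>"])
    show "AE \<omega> in M. (\<lambda>n. \<bar>big (real n) (X 1 \<omega>)\<bar>) \<longlonglongrightarrow> 0"
    proof (rule AE_I2)
      fix \<omega>
      obtain m where "\<bar>X 1 \<omega>\<bar> \<le> real m" using real_arch_simple by blast
      then have "\<forall>\<^sub>F n in sequentially. \<bar>big (real n) (X 1 \<omega>)\<bar> = 0"
        by (intro eventually_sequentiallyI[of m]) (auto simp: big_def)
      then show "(\<lambda>n. \<bar>big (real n) (X 1 \<omega>)\<bar>) \<longlonglongrightarrow> 0" by (rule tendsto_eventually)
    qed
  qed (auto simp: big_def intro: integrable_step)
  then show ?thesis by simp
qed

text \<open>Hoeffding's inequality for \<open>k\<close> independent summands with range of length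
  \<open>2 * T\<close>, whose squared lengths add up to
  \<open>4 * T\<^sup>2 * real k\<close>.\<close>

lemma hoeffding_step:
  assumes T: "T > 0" and k: "1 \<le> k" and e: "0 \<le> \<epsilon>"
  shows "prob {\<omega> \<in> space M. \<epsilon> \<le> \<bar>(\<Sum>i = 1..k. X i \<omega> - big T (X i \<omega>)) - real k * expectation (\<lambda>\<omega>. X 1 \<omega> - big T (X 1 \<omega>))\<bar>}
    \<le> 2 * exp (- \<epsilon>\<^sup>2 / (2 * T\<^sup>2 * real k))"
proof -
  let ?f = "\<lambda>x. x - big T x"
  have b: "?f x \<in> {- T..T}" for x using T by (auto simp: big_def)
  have iv: "indep_vars (\<lambda>_. borel) (\<lambda>i \<omega>. ?f (X i \<omega>)) {1..k}"
    by (rule indep_vars_compose2[where Y = "\<lambda>i x. ?f x", OF indep_vars_subset[OF indep]]) auto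
  have mu: "(\<Sum>i = 1..k. expectation (\<lambda>\<omega>. ?f (X i \<omega>))) = real k * expectation (\<lambda>\<omega>. ?f (X 1 \<omega>))"
  proof -
    have "(\<Sum>i = 1..k. expectation (\<lambda>\<omega>. ?f (X i \<omega>))) = (\<Sum>i = 1..k. expectation (\<lambda>\<omega>. ?f (X 1 \<omega>)))"
      by (intro sum.cong refl expectation_step) auto
    then show ?thesis by simp
  qed
  interpret H: Hoeffding_ineq M "{1..k}" "\<lambda>i \<omega>. ?f (X i \<omega>)" "\<lambda>_. - T" "\<lambda>_. T"
      "\<Sum>i = 1..k. expectation (\<lambda>\<omega>. ?f (X i \<omega>))"
  proof unfold_locales
    show "indep_vars (\<lambda>_. borel) (\<lambda>i \<omega>. ?f (X i \<omega>)) {1..k}" by (rule iv)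
    show "AE \<omega> in M. ?f (X i \<omega>) \<in> {- T..T}" for i
      by (rule AE_I2) (rule b)
  qed simp_all
  have "(\<Sum>i = 1..k. (T - - T)\<^sup>2) = 4 * T\<^sup>2 * real k"
    by (simp add: power2_eq_square)
  with H.Hoeffding_ineq_abs_ge[OF e] T k show ?thesis
    unfolding mu by (simp add: mult_ac)
qed

text \<open>Truncation at a fixed level splits the walk in two. Hoeffding's inequality is summed
  over all \<open>k \<le> n\<close> for the bounded part; Markov's inequality handles the removed
  part. Only a first moment is available.\<close>

lemma maximal_lln:
  assumes d: "d > 0"
  shows "(\<lambda>n. prob {\<omega> \<in> space M. \<exists>k\<le>n. d * real n < \<bar>walk X k \<omega> + \<gamma> * real k\<bar>}) \<longlonglongrightarrow> 0"
proof (rule LIMSEQ_I)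
  fix \<epsilon> :: real assume e: "\<epsilon> > 0"
  \<comment> \<open>The first bound keeps the accumulated truncation bias below
    \<open>d * real n / 4\<close>; the second makes Markov's inequality for \<open>G n\<close> yield
    \<open>\<epsilon> / 2\<close>.\<close>
  define \<delta> where "\<delta> = min (d / 4) (\<epsilon> * d / 8)"
  have dl: "\<delta> > 0" "\<delta> \<le> d / 4" "\<delta> \<le> \<epsilon> * d / 8" using d e by (auto simp: \<delta>_def)
  have "\<forall>\<^sub>F n in sequentially. expectation (\<lambda>\<omega>. \<bar>big (real n) (X 1 \<omega>)\<bar>) < \<delta> \<and> n > 0"
    using order_tendstoD(2)[OF big_expectation_tendsto dl(1)] eventually_gt_at_top[of 0]
    by (rule eventually_conj)
  then obtain m where m: "expectation (\<lambda>\<omega>. \<bar>big (real m) (X 1 \<omega>)\<bar>) < \<delta>" "m > 0"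
    by (auto simp: eventually_sequentially)
  define T where "T = real m"
  have T: "T > 0" using m by (simp add: T_def)
  let ?c = "expectation (\<lambda>\<omega>. X 1 \<omega> - big T (X 1 \<omega>))"
  have c: "\<bar>?c + \<gamma>\<bar> \<le> \<delta>"
  proof -
    have "?c = - \<gamma> - expectation (\<lambda>\<omega>. big T (X 1 \<omega>))"
      using integrable_step big_integrable[of 1 T] mean_step by simp
    moreover have "\<bar>expectation (\<lambda>\<omega>. big T (X 1 \<omega>))\<bar> \<le> expectation (\<lambda>\<omega>. \<bar>big T (X 1 \<omega>)\<bar>)"
      by (rule integral_abs_bound)
    ultimately show ?thesis using m(1) unfolding T_def by linarith
  qed
  define F where "F n k = {\<omega> \<in> space M. d * real n / 2 \<le>
      \<bar>(\<Sum>i = 1..k. X i \<omega> - big T (X i \<omega>)) - real k * ?c\<bar>}" for n k :: nat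
  \<comment> \<open>With absolute values the sum increases with the number of terms, so one event
    controls the removed part for all \<open>k \<le> n\<close> at once.\<close>
  define G where "G n = {\<omega> \<in> space M. d * real n / 4 \<le> (\<Sum>i = 1..n. \<bar>big T (X i \<omega>)\<bar>)}" for n :: nat
  have meas [measurable]: "F n k \<in> events" "G n \<in> events" for n k
  proof -
    have [measurable]: "(\<lambda>\<omega>. \<Sum>i = 1..k. X i \<omega> - big T (X i \<omega>)) \<in> borel_measurable M"
      "(\<lambda>\<omega>. \<Sum>i = 1..n. \<bar>big T (X i \<omega>)\<bar>) \<in> borel_measurable M"
      by (auto intro!: borel_measurable_sum borel_measurable_diff borel_measurable_abs
            measurable_compose[OF _ big_measurable] step_measurable)
    show "F n k \<in> events" "G n \<in> events" unfolding F_def G_def by measurable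
  qed
  have sub: "{\<omega> \<in> space M. \<exists>k\<le>n. d * real n < \<bar>walk X k \<omega> + \<gamma> * real k\<bar>} \<subseteq> (\<Union>k\<in>{1..n}. F n k) \<union> G n"
    for n
  proof safe
    fix \<omega> k assume w: "\<omega> \<in> space M" "k \<le> n" "d * real n < \<bar>walk X k \<omega> + \<gamma> * real k\<bar>" "\<omega> \<notin> G n"
    have "k \<noteq> 0" using w(3) d by (intro notI) (simp add: walk_def mult_less_0_iff)
    \<comment> \<open>Centred truncated sum, removed part and bias. The last two take up at most
      \<open>d / 4\<close> each per unit of \<open>n\<close>, so the first must exceed
      \<open>d / 2\<close>.\<close>
    have "walk X k \<omega> + \<gamma> * real k = ((\<Sum>i = 1..k. X i \<omega> - big T (X i \<omega>)) - real k * ?c)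
        + (\<Sum>i = 1..k. big T (X i \<omega>)) + real k * (?c + \<gamma>)"
      by (simp add: walk_def sum_subtractf algebra_simps)
    moreover have "\<bar>\<Sum>i = 1..k. big T (X i \<omega>)\<bar> \<le> (\<Sum>i = 1..n. \<bar>big T (X i \<omega>)\<bar>)"
      by (rule order_trans[OF sum_abs]) (use w in \<open>auto intro!: sum_mono2\<close>)
    moreover have "\<bar>real k * (?c + \<gamma>)\<bar> \<le> real n * (d / 4)"
      unfolding abs_mult using w c dl by (intro mult_mono) auto
    moreover have "(\<Sum>i = 1..n. \<bar>big T (X i \<omega>)\<bar>) < d * real n / 4"
      using w by (auto simp: G_def)
    ultimately have "d * real n / 2 \<le> \<bar>(\<Sum>i = 1..k. X i \<omega> - big T (X i \<omega>)) - real k * ?c\<bar>"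
      using w(3) by (simp only: mult.commute[of "real n"] times_divide_eq_right)
    then show "\<omega> \<in> (\<Union>k\<in>{1..n}. F n k)"
      using w(1,2) \<open>k \<noteq> 0\<close> by (auto simp: F_def Suc_le_eq intro!: bexI[of _ k])
  qed
  have G: "prob (G n) \<le> \<epsilon> / 2" if n: "n > 0" for n
  proof -
    have int: "integrable M (\<lambda>\<omega>. \<Sum>i = 1..n. \<bar>big T (X i \<omega>)\<bar>)"
      by (intro Bochner_Integration.integrable_sum integrable_abs big_integrable) auto
    have "prob (G n) \<le> expectation (\<lambda>\<omega>. \<Sum>i = 1..n. \<bar>big T (X i \<omega>)\<bar>) / (d * real n / 4)"
      unfolding G_def using d n by (intro integral_Markov_inequality_measure[OF int, where A = "{}"]) (auto intro!: sum_nonneg)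
    also have "expectation (\<lambda>\<omega>. \<Sum>i = 1..n. \<bar>big T (X i \<omega>)\<bar>)
        = real n * expectation (\<lambda>\<omega>. \<bar>big T (X 1 \<omega>)\<bar>)"
    proof -
      have "expectation (\<lambda>\<omega>. \<Sum>i = 1..n. \<bar>big T (X i \<omega>)\<bar>) = (\<Sum>i = 1..n. expectation (\<lambda>\<omega>. \<bar>big T (X i \<omega>)\<bar>))"
        by (intro Bochner_Integration.integral_sum integrable_abs big_integrable) simp
      also have "\<dots> = (\<Sum>i = 1..n. expectation (\<lambda>\<omega>. \<bar>big T (X 1 \<omega>)\<bar>))"
        by (intro sum.cong refl expectation_step) auto
      finally show ?thesis by simp
    qed
    also have "\<dots> / (d * real n / 4) \<le> real n * (\<epsilon> * d / 8) / (d * real n / 4)"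
      using m dl d n by (intro divide_right_mono mult_left_mono) (auto simp: T_def)
    also have "\<dots> = \<epsilon> / 2" using d n by simp
    finally show ?thesis .
  qed
  have F: "prob (F n k) \<le> 2 * exp (- (d\<^sup>2 / (8 * T\<^sup>2)) * real n)" if "k \<in> {1..n}" for n k
  proof -
    have k: "1 \<le> k" "k \<le> n" using that by auto
    have "prob (F n k) \<le> 2 * exp (- (d * real n / 2)\<^sup>2 / (2 * T\<^sup>2 * real k))"
      unfolding F_def using d by (intro hoeffding_step T k) auto
    also have "\<dots> \<le> 2 * exp (- (d * real n / 2)\<^sup>2 / (2 * T\<^sup>2 * real n))"
      using T k by (auto intro!: divide_left_mono mult_left_mono)
    also have "- (d * real n / 2)\<^sup>2 / (2 * T\<^sup>2 * real n) = - (d\<^sup>2 / (8 * T\<^sup>2)) * real n"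
      using T k by (simp add: field_simps power2_eq_square)
    finally show ?thesis .
  qed
  define c1 where "c1 = d\<^sup>2 / (8 * T\<^sup>2)"
  have "c1 > 0" using d T by (simp add: c1_def)
  \<comment> \<open>The union over \<open>k\<close> costs a factor \<open>n\<close>, which the
    exponential bound absorbs.\<close>
  then have "(\<lambda>n. real n * (2 * exp (- c1 * real n))) \<longlonglongrightarrow> 0" by real_asymp
  then have "\<forall>\<^sub>F n in sequentially. real n * (2 * exp (- c1 * real n)) < \<epsilon> / 2"
    using e by (intro order_tendstoD) auto
  then have "\<forall>\<^sub>F n in sequentially. n > 0 \<and> real n * (2 * exp (- c1 * real n)) < \<epsilon> / 2"
    by (intro eventually_conj eventually_gt_at_top)
  then obtain n0 where n0: "\<And>n. n \<ge> n0 \<Longrightarrow> n > 0 \<and> real n * (2 * exp (- c1 * real n)) < \<epsilon> / 2"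
    by (auto simp: eventually_sequentially)
  show "\<exists>no. \<forall>n\<ge>no. norm (prob {\<omega> \<in> space M. \<exists>k\<le>n. d * real n < \<bar>walk X k \<omega> + \<gamma> * real k\<bar>} - 0) < \<epsilon>"
  proof (intro exI allI impI)
    fix n assume "n \<ge> n0"
    note n = n0[OF this]
    have "prob {\<omega> \<in> space M. \<exists>k\<le>n. d * real n < \<bar>walk X k \<omega> + \<gamma> * real k\<bar>}
        \<le> prob ((\<Union>k\<in>{1..n}. F n k) \<union> G n)"
      by (rule finite_measure_mono[OF sub]) (auto intro!: meas)
    also have "\<dots> \<le> prob (\<Union>k\<in>{1..n}. F n k) + prob (G n)"
      by (rule measure_Un_le) (auto intro!: meas)
    also have "prob (\<Union>k\<in>{1..n}. F n k) \<le> (\<Sum>k\<in>{1..n}. prob (F n k))"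
      by (rule finite_measure_subadditive_finite) (auto intro!: meas)
    also have "\<dots> \<le> (\<Sum>k\<in>{1..n}. 2 * exp (- c1 * real n))"
      by (rule sum_mono) (use F in \<open>auto simp: c1_def\<close>)
    also have "\<dots> = real n * (2 * exp (- c1 * real n))" by simp
    finally show "norm (prob {\<omega> \<in> space M. \<exists>k\<le>n. d * real n < \<bar>walk X k \<omega> + \<gamma> * real k\<bar>} - 0) < \<epsilon>"
      using n G[of n] by simp
  qed
qed

text \<open>The event that the walk without its \<open>j\<close>-th step strays from its mean; it is independent of \<open>X j\<close>.\<close>

definition stray :: "nat \<Rightarrow> real \<Rightarrow> nat \<Rightarrow> 'a set" where
  "stray n d j = {\<omega> \<in> space M. \<exists>k\<in>{..n}. d * real n < \<bar>(\<Sum>l\<in>{1..k} - {j}. X l \<omega>) + \<gamma> * real k\<bar>}"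

lemma stray_others: "stray n d j \<in> sets (others j)"
proof -
  have [measurable]: "(\<lambda>\<omega>. \<Sum>l\<in>{1..k} - {j}. X l \<omega>) \<in> borel_measurable (others j)" for k
    by (auto intro!: borel_measurable_sum step_others)
  have "{\<omega> \<in> space (others j). \<exists>k\<in>{..n}. d * real n < \<bar>(\<Sum>l\<in>{1..k} - {j}. X l \<omega>) + \<gamma> * real k\<bar>}
      \<in> sets (others j)"
    by measurable
  then show ?thesis by (simp add: stray_def)
qed

lemma stray_measurable [measurable]: "stray n d j \<in> events"
  using stray_others others_subset by blast

lemma walk_without_step:
  assumes "1 \<le> j"
  shows "(\<Sum>l\<in>{1..k} - {j}. X l \<omega>) = walk X k \<omega> - (if j \<le> k then X j \<omega> else 0)"
proof (cases "j \<le> k")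
  case True
  then show ?thesis using assms by (simp add: walk_def sum_diff1)
next
  case False
  then have "{1..k} - {j} = {1..k}" by auto
  then show ?thesis using False by (simp add: walk_def)
qed

lemma prob_far_step_tendsto:
  assumes "d > 0"
  shows "(\<lambda>n. prob {\<omega> \<in> space M. d * real n < \<bar>X 1 \<omega>\<bar>}) \<longlonglongrightarrow> 0"
proof -
  have [measurable]: "{\<omega> \<in> space M. d * real n < \<bar>X 1 \<omega>\<bar>} \<in> events" for n by measurable
  have "(\<lambda>n. prob {\<omega> \<in> space M. d * real n < \<bar>X 1 \<omega>\<bar>}) \<longlonglongrightarrow> prob (\<Inter>n. {\<omega> \<in> space M. d * real n < \<bar>X 1 \<omega>\<bar>})"
  proof (rule finite_Lim_measure_decseq)
    show "decseq (\<lambda>n. {\<omega> \<in> space M. d * real n < \<bar>X 1 \<omega>\<bar>})"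
    proof (rule decseq_SucI, safe)
      fix n \<omega> assume "d * real (Suc n) < \<bar>X 1 \<omega>\<bar>"
      then show "d * real n < \<bar>X 1 \<omega>\<bar>" using assms by (simp add: algebra_simps)
    qed
  qed auto
  moreover have "(\<Inter>n. {\<omega> \<in> space M. d * real n < \<bar>X 1 \<omega>\<bar>}) = {}"
  proof safe
    fix \<omega> assume *: "\<omega> \<in> (\<Inter>n. {\<omega> \<in> space M. d * real n < \<bar>X 1 \<omega>\<bar>})"
    obtain n :: nat where "\<bar>X 1 \<omega>\<bar> / d \<le> real n" using real_arch_simple by blast
    with * assms show "\<omega> \<in> {}" by (auto simp: field_simps not_less[symmetric])
  qed
  ultimately show ?thesis by simp
qed

text \<open>Leaving out the \<open>j\<close>-th step shifts the walk by at most the size of that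
  step, which exceeds \<open>d / 2 * real n\<close> with vanishing probability; the rest is the
  maximal law of large numbers.\<close>

lemma prob_stray_tendsto:
  assumes d: "d > 0" and j: "1 \<le> j"
  shows "(\<lambda>n. prob (stray n d j)) \<longlonglongrightarrow> 0"
proof (rule tendsto_sandwich[OF _ _ tendsto_const])
  let ?E = "\<lambda>n. {\<omega> \<in> space M. \<exists>k\<le>n. (d / 2) * real n < \<bar>walk X k \<omega> + \<gamma> * real k\<bar>}"
  have X: "prob {\<omega> \<in> space M. (d / 2) * real n < \<bar>X j \<omega>\<bar>} = prob {\<omega> \<in> space M. (d / 2) * real n < \<bar>X 1 \<omega>\<bar>}" for n
  proof -
    have "{x. (d / 2) * real n < \<bar>x :: real\<bar>} \<in> sets borel" by measurable
    from prob_step[OF j this] show ?thesis by simp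
  qed
  have "prob (stray n d j) \<le> prob (?E n) + prob {\<omega> \<in> space M. (d / 2) * real n < \<bar>X 1 \<omega>\<bar>}" for n
  proof -
    have [measurable]: "X j \<in> borel_measurable M" by (rule step_measurable[OF j])
    have "prob (stray n d j) \<le> prob (?E n \<union> {\<omega> \<in> space M. (d / 2) * real n < \<bar>X j \<omega>\<bar>})"
    proof (rule finite_measure_mono)
      show "stray n d j \<subseteq> ?E n \<union> {\<omega> \<in> space M. (d / 2) * real n < \<bar>X j \<omega>\<bar>}"
      proof
        fix \<omega> assume "\<omega> \<in> stray n d j"
        then obtain k where k: "\<omega> \<in> space M" "k \<le> n" "d * real n < \<bar>(\<Sum>l\<in>{1..k} - {j}. X l \<omega>) + \<gamma> * real k\<bar>"
          by (auto simp: stray_def)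
        have "\<bar>(\<Sum>l\<in>{1..k} - {j}. X l \<omega>) + \<gamma> * real k\<bar> \<le> \<bar>walk X k \<omega> + \<gamma> * real k\<bar> + \<bar>X j \<omega>\<bar>"
          unfolding walk_without_step[OF j] by auto
        moreover have "d * real n = d / 2 * real n + d / 2 * real n" by simp
        ultimately have "(d / 2) * real n < \<bar>walk X k \<omega> + \<gamma> * real k\<bar> \<or> (d / 2) * real n < \<bar>X j \<omega>\<bar>"
          using k(3) by linarith
        with k(1,2) show "\<omega> \<in> ?E n \<union> {\<omega> \<in> space M. (d / 2) * real n < \<bar>X j \<omega>\<bar>}" by auto
      qed
    qed measurable
    also have "\<dots> \<le> prob (?E n) + prob {\<omega> \<in> space M. (d / 2) * real n < \<bar>X j \<omega>\<bar>}"
      by (rule measure_Un_le) measurable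
    finally show ?thesis unfolding X .
  qed
  then show "\<forall>\<^sub>F n in sequentially. prob (stray n d j) \<le> prob (?E n) + prob {\<omega> \<in> space M. (d / 2) * real n < \<bar>X 1 \<omega>\<bar>}"
    by simp
  show "(\<lambda>n. prob (?E n) + prob {\<omega> \<in> space M. (d / 2) * real n < \<bar>X 1 \<omega>\<bar>}) \<longlonglongrightarrow> 0"
    using tendsto_add[OF maximal_lln prob_far_step_tendsto, of "d / 2" "d / 2"] d by simp
qed simp

end

subsection \<open>Survival without a large jump\<close>

context drift_walk
begin

text \<open>An exponential weight killed at steps of size at least \<open>y\<close>: the product
  over the steps is the exponential of the walk if there is no such step, and \<open>0\<close>
  otherwise.\<close>

definition capped_exp :: "real \<Rightarrow> real \<Rightarrow> real \<Rightarrow> real" where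
  "capped_exp t y x = (if x < y then exp (t * x) else 0)"

lemma capped_exp_measurable [measurable]: "capped_exp t y \<in> borel_measurable borel"
  unfolding capped_exp_def by measurable

text \<open>The error term is quadratic near \<open>0\<close> but only linear far out, so that its
  expectation is controlled by the first moment of a step with possibly infinite variance.\<close>

lemma exp_le_quadratic:
  fixes u :: real
  assumes "u \<le> 1"
  shows "exp u \<le> 1 + u + \<bar>u\<bar> * min 1 \<bar>u\<bar>"
proof -
  consider "u < - 1" | "- 1 \<le> u" "u \<le> 0" | "0 \<le> u" by linarith
  then show ?thesis
  proof cases
    case 1
    then have "exp u \<le> 1" by simp
    then show ?thesis using 1 by simp
  next
    case 2
    have "exp u = 1 / exp (- u)" by (simp add: exp_minus inverse_eq_divide)
    also have "\<dots> \<le> 1 / (1 - u)"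
      using 2 exp_ge_add_one_self[of "- u"] by (intro divide_left_mono) auto
    also have "\<dots> \<le> 1 + u + u * u"
    proof -
      have "0 \<le> (- u) ^ 3" using 2 by (intro zero_le_power) auto
      moreover have "(1 + u + u * u) * (1 - u) = 1 + (- u) ^ 3"
        by (simp add: algebra_simps power3_eq_cube)
      ultimately have "1 \<le> (1 + u + u * u) * (1 - u)" by linarith
      moreover have "0 < 1 - u" using 2 by linarith
      ultimately show ?thesis by (simp only: pos_divide_le_eq)
    qed
    also have "u * u = \<bar>u\<bar> * min 1 \<bar>u\<bar>"
    proof -
      have "\<bar>u\<bar> = - u" "min 1 \<bar>u\<bar> = - u" using 2 by linarith+
      then show ?thesis by (simp only: minus_mult_minus)
    qed
    finally show ?thesis .
  next
    case 3
    have "exp u \<le> 1 + u + u\<^sup>2" using 3 assms by (rule exp_bound)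
    also have "u\<^sup>2 = \<bar>u\<bar> * min 1 \<bar>u\<bar>" 
    proof -
      have "\<bar>u\<bar> = u" "min 1 \<bar>u\<bar> = u" using 3 assms by linarith+
      then show ?thesis by (simp only: power2_eq_square)
    qed
    finally show ?thesis .
  qed
qed

text \<open>Below \<open>1 / t\<close> the quadratic bound applies to \<open>t * x\<close>. From
  \<open>1 / t\<close> on, the cap bounds the weight by \<open>exp (t * y)\<close>.\<close>

lemma capped_exp_le:
  assumes t: "t > 0" and y: "y > 0"
  shows "capped_exp t y x \<le> 1 + t * x + t * (\<bar>x\<bar> * min 1 (t * \<bar>x\<bar>)) + exp (t * y) * indicator {1 / t..} x"
proof (cases "t * x < 1")
  case True
  have "exp (t * x) \<le> 1 + t * x + \<bar>t * x\<bar> * min 1 \<bar>t * x\<bar>"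
    using True by (intro exp_le_quadratic) simp
  also have "\<bar>t * x\<bar> = t * \<bar>x\<bar>" using t by (simp add: abs_mult)
  finally have "exp (t * x) \<le> 1 + t * x + t * (\<bar>x\<bar> * min 1 (t * \<bar>x\<bar>))" by (simp add: mult_ac)
  moreover have "x \<notin> {1 / t..}" using True t by (auto simp: field_simps)
  moreover have "capped_exp t y x \<le> exp (t * x)" by (simp add: capped_exp_def)
  ultimately show ?thesis by simp
next
  case False
  then have "x \<in> {1 / t..}" using t by (auto simp: field_simps)
  moreover have "capped_exp t y x \<le> exp (t * y)" using t by (simp add: capped_exp_def)
  moreover have "0 \<le> t * (\<bar>x\<bar> * min 1 (t * \<bar>x\<bar>))" using t by simp
  ultimately show ?thesis using False by simp
qed

text \<open>The second-order correction of the Laplace transform divided by \<open>t\<close>. It is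
  finite under a first moment and tends to \<open>0\<close> with \<open>t\<close>, so the correction
  is of smaller order than the drift term \<open>t * \<gamma>\<close>.\<close>

definition curvature :: "real \<Rightarrow> real" where
  "curvature t = expectation (\<lambda>\<omega>. \<bar>X 1 \<omega>\<bar> * min 1 (t * \<bar>X 1 \<omega>\<bar>))"

lemma curvature_integrable:
  assumes "t > 0"
  shows "integrable M (\<lambda>\<omega>. \<bar>X 1 \<omega>\<bar> * min 1 (t * \<bar>X 1 \<omega>\<bar>))"
  by (rule Bochner_Integration.integrable_bound[OF integrable_step])
     (use assms in \<open>auto simp: abs_mult intro!: mult_left_le\<close>)

lemma curvature_tendsto:
  assumes t: "\<And>n. t n > 0" "t \<longlonglongrightarrow> 0"
  shows "(\<lambda>n. curvature (t n)) \<longlonglongrightarrow> 0"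
proof -
  have "(\<lambda>n. curvature (t n)) \<longlonglongrightarrow> expectation (\<lambda>\<omega>. 0)"
    unfolding curvature_def
  proof (rule integral_dominated_convergence[where w = "\<lambda>\<omega>. \<bar>X 1 \<omega>\<bar>"])
    show "AE \<omega> in M. (\<lambda>n. \<bar>X 1 \<omega>\<bar> * min 1 (t n * \<bar>X 1 \<omega>\<bar>)) \<longlonglongrightarrow> 0"
    proof (rule AE_I2)
      fix \<omega>
      have "(\<lambda>n. \<bar>X 1 \<omega>\<bar> * min 1 (t n * \<bar>X 1 \<omega>\<bar>)) \<longlonglongrightarrow> \<bar>X 1 \<omega>\<bar> * min 1 (0 * \<bar>X 1 \<omega>\<bar>)"
        by (intro tendsto_intros t)
      then show "(\<lambda>n. \<bar>X 1 \<omega>\<bar> * min 1 (t n * \<bar>X 1 \<omega>\<bar>)) \<longlonglongrightarrow> 0" by simp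
    qed
    show "AE \<omega> in M. norm (\<bar>X 1 \<omega>\<bar> * min 1 (t n * \<bar>X 1 \<omega>\<bar>)) \<le> \<bar>X 1 \<omega>\<bar>" for n
      using t(1)[of n] by (auto simp: abs_mult intro!: mult_left_le)
  qed (auto intro: integrable_abs integrable_step)
  then show ?thesis by simp
qed

lemma capped_exp_integrable:
  assumes "t > 0" "1 \<le> i"
  shows "integrable M (\<lambda>\<omega>. capped_exp t y (X i \<omega>))"
proof (rule integrable_const_bound[where B = "exp (t * y)"])
  show "AE \<omega> in M. norm (capped_exp t y (X i \<omega>)) \<le> exp (t * y)"
    using assms by (auto simp: capped_exp_def)
qed (auto intro: measurable_compose[OF step_measurable[OF assms(2)]])

lemma expectation_capped_exp_le:
  assumes t: "t > 0" and y: "y > 0"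
  shows "expectation (\<lambda>\<omega>. capped_exp t y (X 1 \<omega>)) \<le>
    1 - t * \<gamma> + t * curvature t + exp (t * y) * tail (1 / t)"
proof -
  have i1: "integrable M (\<lambda>\<omega>. indicator {1 / t..} (X 1 \<omega>) :: real)"
    by (rule integrable_const_bound[where B = 1]) (auto simp: indicator_def)
  have "expectation (\<lambda>\<omega>. capped_exp t y (X 1 \<omega>)) \<le>
    expectation (\<lambda>\<omega>. 1 + t * X 1 \<omega> + t * (\<bar>X 1 \<omega>\<bar> * min 1 (t * \<bar>X 1 \<omega>\<bar>)) + exp (t * y) * indicator {1 / t..} (X 1 \<omega>))"
    by (intro integral_mono capped_exp_integrable t capped_exp_le[OF t y]
          Bochner_Integration.integrable_add integrable_mult_right integrable_step curvature_integrable i1)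
       auto
  also have "\<dots> = 1 + t * expectation (X 1) + t * curvature t + exp (t * y) * expectation (\<lambda>\<omega>. indicator {1 / t..} (X 1 \<omega>))"
    using integrable_step curvature_integrable[OF t] i1
    by (simp add: curvature_def prob_space)
  also have "expectation (\<lambda>\<omega>. indicator {1 / t..} (X 1 \<omega>)) = tail (1 / t)"
  proof -
    have "expectation (\<lambda>\<omega>. indicator {1 / t..} (X 1 \<omega>)) = expectation (indicator {\<omega> \<in> space M. 1 / t \<le> X 1 \<omega>})"
      by (rule Bochner_Integration.integral_cong) (auto simp: indicator_def)
    also have "\<dots> = tail (1 / t)"
      by (simp add: tail_def)
    finally show ?thesis .
  qed
  finally show ?thesis by (simp add: mean_step)
qed

definition no_jump :: "nat \<Rightarrow> real \<Rightarrow> 'a set" where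
  "no_jump n y = {\<omega> \<in> space M. \<forall>i\<in>{1..<n}. X i \<omega> < y}"

lemma no_jump_measurable [measurable]: "no_jump n y \<in> events"
proof -
  have "{\<omega> \<in> space M. X i \<omega> < y} \<in> events" if "i \<in> {1..<n}" for i
    using step_measurable[of i] that by simp
  then show ?thesis unfolding no_jump_def by (intro sets.sets_Collect_finite_All) auto
qed

text \<open>Chernoff bound: on the event the product of the capped weights is
  \<open>exp (t * walk X (n - 1) \<omega>)\<close>, which is at least \<open>1\<close> by survival.
  Independence factorises its expectation.\<close>

lemma prob_no_jump_le:
  assumes t: "t > 0" and n: "n \<ge> 2"
  shows "prob (surv n \<inter> no_jump n y) \<le> (expectation (\<lambda>\<omega>. capped_exp t y (X 1 \<omega>))) ^ (n - 1)"
proof -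
  let ?f = "\<lambda>i \<omega>. capped_exp t y (X i \<omega>)"
  have iv: "indep_vars (\<lambda>_. borel) ?f {1..<n}"
    by (rule indep_vars_compose2[where Y = "\<lambda>i x. capped_exp t y x", OF indep_vars_subset[OF indep]]) auto
  have int: "integrable M (?f i)" if "i \<in> {1..<n}" for i
    using capped_exp_integrable t that by auto
  have "prob (surv n \<inter> no_jump n y) = expectation (indicator (surv n \<inter> no_jump n y))"
    by simp
  also have "\<dots> \<le> expectation (\<lambda>\<omega>. \<Prod>i\<in>{1..<n}. ?f i \<omega>)"
  proof (rule integral_mono)
    show "integrable M (\<lambda>\<omega>. \<Prod>i\<in>{1..<n}. ?f i \<omega>)"
      by (rule indep_vars_integrable) (use iv int in auto)
    show "indicator (surv n \<inter> no_jump n y) \<omega> \<le> (\<Prod>i\<in>{1..<n}. ?f i \<omega>)" if "\<omega> \<in> space M" for \<omega>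
    proof (cases "\<omega> \<in> surv n \<inter> no_jump n y")
      case True
      then have "(\<Prod>i\<in>{1..<n}. ?f i \<omega>) = (\<Prod>i\<in>{1..<n}. exp (t * X i \<omega>))"
        by (intro prod.cong) (auto simp: no_jump_def capped_exp_def)
      also have "\<dots> = exp (t * walk X (n - 1) \<omega>)"
        using n by (simp add: exp_sum walk_def sum_distrib_left) (rule prod.cong; auto)
      also have "1 \<le> \<dots>" using True t n by (auto simp: surv_eq)
      finally show ?thesis using True by simp
    qed (auto intro!: prod_nonneg simp: capped_exp_def)
  qed (auto simp: integrable_indicator_iff emeasure_eq_measure)
  also have "\<dots> = (\<Prod>i\<in>{1..<n}. expectation (?f i))"
    by (rule indep_vars_lebesgue_integral) (use iv int in auto)
  also have "\<dots> = (\<Prod>i\<in>{1..<n}. expectation (\<lambda>\<omega>. capped_exp t y (X 1 \<omega>)))"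
    by (rule prod.cong[OF refl]) (rule expectation_step, auto)
  finally show ?thesis by simp
qed

lemma no_jump_negligible:
  obtains \<eta> where "\<eta> > 0" "(\<lambda>n. prob (surv n \<inter> no_jump n (\<eta> * real n)) / tail (\<gamma> * real n)) \<longlonglongrightarrow> 0"
proof
  \<comment> \<open>With parameter \<open>K ln n / n\<close> the bound is \<open>n powr (- K \<gamma> / 4)\<close>, of smaller order than the tail. The
    steps between \<open>n / (K ln n)\<close> and \<open>\<eta> n\<close> contribute at most \<open>n powr (K \<eta>)\<close> times their probability,
    which forces \<open>K \<eta> < \<beta> - 1\<close>.\<close>
  define K where "K = 4 * (\<beta> + 2) / \<gamma>"
  define s where "s = (\<beta> - 1) / 4"
  define \<eta> where "\<eta> = s / K"
  have pos: "K > 0" "s > 0" using index drift by (auto simp: K_def s_def)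
  then show eta: "\<eta> > 0" by (simp add: \<eta>_def)
  \<comment> \<open>The exponent \<open>1 + 2 * s\<close> is the midpoint of \<open>1\<close> and
    \<open>\<beta>\<close>: below the index, yet leaving a surplus \<open>2 * s\<close> over the
    first power of \<open>t n\<close>.\<close>
  obtain C x0 where C: "C > 0" "x0 > 0" "\<And>x. x \<ge> x0 \<Longrightarrow> tail x \<le> C * x powr - (1 + 2 * s)"
    using tail.tail_upper[of "1 + 2 * s"] index by (auto simp: s_def field_simps)
  obtain C' x0' where C': "C' > 0" "x0' > 0" "\<And>x. x \<ge> x0' \<Longrightarrow> C' * x powr - (\<beta> + 1) \<le> tail x"
    using tail.tail_lower[of "\<beta> + 1"] index by auto
  \<comment> \<open>The shift by \<open>2\<close> keeps the parameter positive for every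
    \<open>n\<close>, including \<open>0\<close>.\<close>
  define t where "t n = K * ln (real n + 2) / (real n + 2)" for n
  have tpos: "t n > 0" for n using pos by (simp add: t_def)
  have t0: "t \<longlonglongrightarrow> 0" unfolding t_def by real_asymp
  \<comment> \<open>This is the contribution of the intermediate steps divided by
    \<open>t n\<close>. It is a constant times the power \<open>2 * s\<close> of
    \<open>(real n + 2) powr (1 / 2) * t n\<close>, which decays like \<open>ln n\<close> over the
    square root of \<open>n\<close>.\<close>
  have "(\<lambda>n. C * exp (s * ln (real n + 2)) * t n powr (2 * s)) \<longlonglongrightarrow> 0"
  proof -
    define g where "g n = (real n + 2) powr (1 / 2) * t n" for n
    have "g \<longlonglongrightarrow> 0" unfolding g_def t_def by real_asymp
    then have "(\<lambda>n. g n powr (2 * s)) \<longlonglongrightarrow> 0"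
      by (rule tendsto_zero_powrI[OF _ tendsto_const])
        (use pos tpos in \<open>simp_all add: g_def less_imp_le\<close>)
    then have "(\<lambda>n. C * g n powr (2 * s)) \<longlonglongrightarrow> 0"
      by (rule tendsto_mult_right_zero)
    moreover have "C * g n powr (2 * s) = C * exp (s * ln (real n + 2)) * t n powr (2 * s)" for n
      using tpos[of n] by (simp add: g_def powr_mult powr_powr) (simp add: powr_def)
    ultimately show ?thesis by simp
  qed
  then have ev1: "\<forall>\<^sub>F n in sequentially. C * exp (s * ln (real n + 2)) * t n powr (2 * s) < \<gamma> / 4"
    using drift by (intro order_tendstoD) auto
  have ev2: "\<forall>\<^sub>F n in sequentially. curvature (t n) < \<gamma> / 4"
    using curvature_tendsto[OF tpos t0] drift by (intro order_tendstoD) auto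
  have ev3: "\<forall>\<^sub>F n in sequentially. x0 \<le> 1 / t n"
    unfolding t_def using pos by real_asymp
  have ev4: "\<forall>\<^sub>F n in sequentially. x0' \<le> \<gamma> * real n"
    using drift by real_asymp
  show "(\<lambda>n. prob (surv n \<inter> no_jump n (\<eta> * real n)) / tail (\<gamma> * real n)) \<longlonglongrightarrow> 0"
  proof (rule tendsto_sandwich[OF _ _ tendsto_const])
    show "\<forall>\<^sub>F n in sequentially. 0 \<le> prob (surv n \<inter> no_jump n (\<eta> * real n)) / tail (\<gamma> * real n)"
      by (simp add: tail.tail_nonneg)
    \<comment> \<open>The numerator is of order \<open>n powr - (\<beta> + 2)\<close> and the tail
      is at least of order \<open>n powr - (\<beta> + 1)\<close>, leaving
      \<open>1 / n\<close>.\<close>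
    show "(\<lambda>n. \<gamma> powr (\<beta> + 1) / C' * (1 / (real n + 2))) \<longlonglongrightarrow> 0"
      by real_asymp
    show "\<forall>\<^sub>F n in sequentially. prob (surv n \<inter> no_jump n (\<eta> * real n)) / tail (\<gamma> * real n)
        \<le> \<gamma> powr (\<beta> + 1) / C' * (1 / (real n + 2))"
      using ev1 ev2 ev3 ev4 eventually_ge_at_top[of 4]
    proof eventually_elim
      case (elim n)
      let ?E = "expectation (\<lambda>\<omega>. capped_exp (t n) (\<eta> * real n) (X 1 \<omega>))"
      have "exp (t n * (\<eta> * real n)) \<le> exp (s * ln (real n + 2))"
      proof -
        have "t n * (\<eta> * real n) = s * ln (real n + 2) * (real n / (real n + 2))"
          using pos by (simp add: t_def \<eta>_def field_simps)
        also have "\<dots> \<le> s * ln (real n + 2)"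
          using pos by (intro mult_left_le) auto
        finally show ?thesis by simp
      qed
      moreover have "tail (1 / t n) \<le> C * (t n powr (2 * s) * t n)"
      proof -
        have "(1 / t n) powr - a = t n powr a" for a
          using tpos[of n] by (simp add: powr_divide powr_minus)
        then have "(1 / t n) powr - (1 + 2 * s) = t n powr (1 + 2 * s)" .
        also have "\<dots> = t n powr (2 * s) * t n"
          using tpos[of n] unfolding powr_add by simp
        finally show ?thesis
          using C(3)[OF elim(3)] by simp
      qed
      ultimately have "exp (t n * (\<eta> * real n)) * tail (1 / t n)
          \<le> exp (s * ln (real n + 2)) * (C * (t n powr (2 * s) * t n))"
        by (intro mult_mono) (auto simp: tail.tail_nonneg)
      also have "\<dots> = (C * exp (s * ln (real n + 2)) * t n powr (2 * s)) * t n" by (simp add: mult_ac)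
      also have "\<dots> \<le> \<gamma> / 4 * t n"
        using elim(1) tpos[of n] by (intro mult_right_mono) auto
      finally have 1: "exp (t n * (\<eta> * real n)) * tail (1 / t n) \<le> \<gamma> / 4 * t n" .
      have 2: "t n * curvature (t n) \<le> t n * (\<gamma> / 4)"
        using elim(2) tpos[of n] by (intro mult_left_mono) auto
      have "0 < \<eta> * real n" using eta elim by simp
      \<comment> \<open>The two corrections each use up a quarter of the drift term, so half of it
        remains.\<close>
      from expectation_capped_exp_le[OF tpos[of n] this] 1 2
      have "?E \<le> 1 - t n * \<gamma> / 2" by (simp add: field_simps)
      also have "\<dots> \<le> exp (- (t n * \<gamma> / 2))" using exp_ge_add_one_self[of "- (t n * \<gamma> / 2)"] by simp
      finally have E: "?E \<le> exp (- (t n * \<gamma> / 2))" .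
      have E0: "0 \<le> ?E" by (intro integral_nonneg_AE) (auto simp: capped_exp_def)
      have "prob (surv n \<inter> no_jump n (\<eta> * real n)) \<le> ?E ^ (n - 1)"
        using elim by (intro prob_no_jump_le tpos) auto
      also have "\<dots> \<le> exp (- (t n * \<gamma> / 2)) ^ (n - 1)"
        by (intro power_mono E E0)
      also have "\<dots> = exp (- (real (n - 1) * (t n * \<gamma> / 2)))"
        by (simp add: exp_of_nat_mult[symmetric])
      also have "\<dots> \<le> exp (- ((real n + 2) / 2 * (t n * \<gamma> / 2)))"
      proof -
        \<comment> \<open>This comparison is where \<open>n \<ge> 4\<close> enters.\<close>
        have "(real n + 2) / 2 \<le> real (n - 1)" using elim by (simp add: of_nat_diff)
        then have "(real n + 2) / 2 * (t n * \<gamma> / 2) \<le> real (n - 1) * (t n * \<gamma> / 2)"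
          using tpos[of n] drift by (intro mult_right_mono) auto
        then show ?thesis by simp
      qed
      also have "(real n + 2) / 2 * (t n * \<gamma> / 2) = (\<beta> + 2) * ln (real n + 2)"
      proof -
        have "t n * (real n + 2) = K * ln (real n + 2)" by (simp add: t_def)
        moreover have "K * \<gamma> = 4 * (\<beta> + 2)" using drift by (simp add: K_def)
        moreover have "(real n + 2) / 2 * (t n * \<gamma> / 2) = t n * (real n + 2) * \<gamma> / 4" by simp
        ultimately show ?thesis by (simp add: mult_ac)
      qed
      also have "exp (- ((\<beta> + 2) * ln (real n + 2))) = (real n + 2) powr - (\<beta> + 2)"
        by (simp add: powr_def algebra_simps)
      finally have num: "prob (surv n \<inter> no_jump n (\<eta> * real n)) \<le> (real n + 2) powr - (\<beta> + 2)" .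
      have "prob (surv n \<inter> no_jump n (\<eta> * real n)) / tail (\<gamma> * real n)
          \<le> (real n + 2) powr - (\<beta> + 2) / (C' * (\<gamma> * real n) powr - (\<beta> + 1))"
        using num C'(3)[OF elim(4)] C'(1) elim drift by (intro frac_le) auto
      also have "\<dots> = (real n + 2) powr - (\<beta> + 2) * (\<gamma> * real n) powr (\<beta> + 1) / C'"
        unfolding powr_minus[of "\<gamma> * real n"] by (simp add: divide_inverse)
      also have "\<dots> \<le> (real n + 2) powr - (\<beta> + 2) * (\<gamma> * (real n + 2)) powr (\<beta> + 1) / C'"
        using C'(1) drift index by (intro divide_right_mono mult_left_mono powr_mono2) auto
      also have "(real n + 2) powr - (\<beta> + 2) * (\<gamma> * (real n + 2)) powr (\<beta> + 1)
          = \<gamma> powr (\<beta> + 1) * ((real n + 2) powr (- (\<beta> + 2) + (\<beta> + 1)))"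
        using drift by (simp only: powr_add powr_mult mult_ac)
      also have "- (\<beta> + 2) + (\<beta> + 1) = - 1" by simp
      finally show ?case by (simp add: powr_minus_divide mult.commute)
    qed
  qed
qed

end

subsection \<open>Survival and a single large jump\<close>

lemma sum_lessThan_Suc_shift: "(\<Sum>i<J. f (Suc i)) = (\<Sum>i = 1..J. f i)"
  by (simp add: sum.atLeast1_atMost_eq One_nat_def)

text \<open>The second Bonferroni inequality, by induction: adding one more set overcounts its
  overlap with the earlier union by at most the sum of the pairwise overlaps.\<close>

lemma (in finite_measure) bonferroni_lower:
  fixes J :: nat
  assumes B: "\<And>j. B j \<in> sets M"
  shows "(\<Sum>j = 1..J. measure M (B j)) \<le>
    measure M (\<Union>j\<in>{1..J}. B j) + (\<Sum>j = 1..J. \<Sum>i = 1..<j. measure M (B i \<inter> B j))"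
proof (induction J)
  case (Suc J)
  let ?U = "\<Union>j\<in>{1..J}. B j"
  have U: "?U \<in> sets M" using B by auto
  have "measure M (?U \<inter> B (Suc J)) = measure M (\<Union>i\<in>{1..J}. B i \<inter> B (Suc J))"
    by (rule arg_cong[where f = "measure M"]) auto
  also have "\<dots> \<le> (\<Sum>i = 1..J. measure M (B i \<inter> B (Suc J)))"
    by (rule finite_measure_subadditive_finite) (use B in auto)
  finally have 1: "measure M (?U \<inter> B (Suc J)) \<le> (\<Sum>i = 1..<Suc J. measure M (B i \<inter> B (Suc J)))"
    by (simp add: atLeastLessThanSuc_atLeastAtMost)
  have "(\<Union>j\<in>{1..Suc J}. B j) = ?U \<union> B (Suc J)"
    by (auto simp: atLeastAtMostSuc_conv)
  moreover have "measure M (?U \<union> B (Suc J)) = measure M ?U + measure M (B (Suc J)) - measure M (?U \<inter> B (Suc J))"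
    using U B by (intro measure_Un3) (auto simp: fmeasurable_eq_sets)
  ultimately show ?case using Suc 1 by simp
qed simp

section \<open>The expected survival time as a convergent series\<close>

context drift_walk
begin

text \<open>\<open>enn2real\<close> maps \<open>\<infinity>\<close> to \<open>0\<close>, so this is
  the expectation only when it is finite; statements that rely on it assume finiteness.\<close>

definition mean_zeta :: real where
  "mean_zeta = enn2real (expected_zeta M X)"

lemma zeta_measurable: "zeta X \<in> measurable M (count_space UNIV)"
proof -
  have "zeta X -` {e} \<inter> space M \<in> events" for e
  proof (cases e)
    case (enat n)
    have "zeta X -` {enat n} \<inter> space M = surv n - surv (Suc n)"
      by (auto simp: surv_def) (metis Suc_ile_eq order_less_le)+
    then show ?thesis using enat by simp
  next
    case infinity
    have "zeta X -` {\<infinity>} \<inter> space M = (\<Inter>n. surv n)"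
      by (auto simp: surv_def) (metis not_infinity_eq Suc_n_not_le_n enat_ord_simps(1))+
    then show ?thesis using infinity by auto
  qed
  then show ?thesis
    by (simp add: measurable_count_space_eq2_countable)
qed

text \<open>The layer-cake formula for a variable with values in \<open>enat\<close>. Since
  \<open>t < zeta\<close> means \<open>Suc t \<le> zeta\<close>, the series starts with
  \<open>surv 1\<close>.\<close>

lemma surv_sums:
  assumes "expected_zeta M X < \<infinity>"
  shows "(\<lambda>j. prob (surv (Suc j))) sums mean_zeta"
proof -
  have "expected_zeta M X = (\<Sum>t. emeasure M {\<omega> \<in> space M. enat t < zeta X \<omega>})"
    unfolding expected_zeta_def by (rule nn_integral_enat_function[OF zeta_measurable])
  also have "\<dots> = (\<Sum>t. ennreal (prob (surv (Suc t))))"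
    by (simp add: surv_def Suc_ile_eq emeasure_eq_measure)
  finally have eq: "(\<Sum>t. ennreal (prob (surv (Suc t)))) = expected_zeta M X" by simp
  have "summable (\<lambda>t. prob (surv (Suc t)))"
    by (rule summable_suminf_not_top) (use eq assms in auto)
  moreover from this have "ennreal (\<Sum>t. prob (surv (Suc t))) = expected_zeta M X"
    unfolding eq[symmetric] by (intro suminf_ennreal2[symmetric]) auto
  then have "mean_zeta = (\<Sum>t. prob (surv (Suc t)))"
    unfolding mean_zeta_def by (metis enn2real_ennreal suminf_nonneg calculation measure_nonneg)
  ultimately show ?thesis by (simp add: summable_sums)
qed

text \<open>For finite expectation this is the remainder of the series after \<open>J\<close> terms,
  which measures the weight of jumps later than \<open>J\<close>.\<close>

definition excess :: "nat \<Rightarrow> real" where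
  "excess J = mean_zeta - (\<Sum>i = 1..J. prob (surv i))"

lemma excess_tendsto:
  assumes "expected_zeta M X < \<infinity>"
  shows "excess \<longlonglongrightarrow> 0"
proof -
  have "(\<lambda>J. \<Sum>i<J. prob (surv (Suc i))) \<longlonglongrightarrow> mean_zeta"
    using surv_sums[OF assms] by (simp add: sums_def)
  then have "(\<lambda>J. mean_zeta - (\<Sum>i<J. prob (surv (Suc i)))) \<longlonglongrightarrow> mean_zeta - mean_zeta"
    by (intro tendsto_intros)
  moreover have "(\<Sum>i<J. prob (surv (Suc i))) = (\<Sum>i = 1..J. prob (surv i))" for J
    by (rule sum_lessThan_Suc_shift)
  ultimately show ?thesis by (simp add: excess_def[abs_def])
qed

lemma sum_surv_le_excess:
  assumes "expected_zeta M X < \<infinity>" "J < n"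
  shows "(\<Sum>i\<in>{J<..<n}. prob (surv i)) \<le> excess J"
proof -
  have "(\<Sum>i = 1..J. prob (surv i)) + (\<Sum>i\<in>{J<..<n}. prob (surv i)) = (\<Sum>i\<in>{1..J} \<union> {J<..<n}. prob (surv i))"
    by (rule sum.union_disjoint[symmetric]) auto
  also have "{1..J} \<union> {J<..<n} = Suc ` {..<n - 1}"
    using assms(2) by (auto simp: lessThan_atLeast0 image_Suc_atLeastLessThan One_nat_def)
  also have "(\<Sum>i\<in>Suc ` {..<n - 1}. prob (surv i)) = (\<Sum>i<n - 1. prob (surv (Suc i)))"
    by (subst sum.reindex) auto
  also have "\<dots> \<le> mean_zeta"
    using surv_sums[OF assms(1)] sum_le_suminf[of "\<lambda>j. prob (surv (Suc j))" "{..<n - 1}"]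
    by (simp add: sums_iff)
  finally show ?thesis by (simp add: excess_def)
qed

text \<open>The first term of the series is already \<open>1\<close>, as \<open>surv 1\<close> is
  the whole space. Mainly used for positivity.\<close>

lemma mean_zeta_ge_1:
  assumes "expected_zeta M X < \<infinity>"
  shows "mean_zeta \<ge> 1"
proof -
  have "(\<Sum>i<1. prob (surv (Suc i))) \<le> (\<Sum>i. prob (surv (Suc i)))"
    using surv_sums[OF assms] by (intro sum_le_suminf) (auto simp: sums_iff)
  moreover have "surv 1 = space M" by (auto simp: surv_eq)
  ultimately show ?thesis
    using surv_sums[OF assms] by (simp add: sums_iff prob_space One_nat_def)
qed

lemma tail_seq_tendsto: "(\<lambda>n. tail (\<gamma> * real n)) \<longlonglongrightarrow> 0"
proof (rule tendsto_sandwich[OF _ _ tendsto_const])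
  show "(\<lambda>n. prob {\<omega> \<in> space M. \<gamma> / 2 * real n < \<bar>X 1 \<omega>\<bar>}) \<longlonglongrightarrow> 0"
    using drift by (intro prob_far_step_tendsto) simp
  show "\<forall>\<^sub>F n in sequentially. tail (\<gamma> * real n) \<le> prob {\<omega> \<in> space M. \<gamma> / 2 * real n < \<bar>X 1 \<omega>\<bar>}"
    using eventually_gt_at_top[of 0]
  proof eventually_elim
    case (elim n)
    then have "\<gamma> / 2 * real n < \<gamma> * real n" using drift by simp
    then show ?case
      unfolding tail_def by (intro finite_measure_mono) (fastforce, measurable)
  qed
qed (simp add: tail_def)

section \<open>Upper bound for the survival probability\<close>

lemma jump_measurable: "1 \<le> i \<Longrightarrow> {\<omega> \<in> space M. x \<le> X i \<omega>} \<in> events"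
  using step_measurable[of i] by simp

lemma prob_stray_jump:
  assumes "1 \<le> i"
  shows "prob (stray n d i \<inter> {\<omega> \<in> space M. x \<le> X i \<omega>}) = prob (stray n d i) * tail x"
  using indep_others[OF assms stray_others, of "{x..}"] by (simp add: tail_def)

text \<open>Unless the remaining steps stray from their mean, the walk at time \<open>n - 1\<close>
  is close to \<open>X i - \<gamma> * n\<close>, so survival forces the \<open>i\<close>-th step to
  be nearly \<open>\<gamma> * n\<close>, whatever the initial threshold \<open>x\<close>.\<close>

lemma prob_surv_jump_le:
  assumes i: "1 \<le> i" "i < n" and \<delta>: "0 < \<delta>" and n: "2 < \<delta> * real n"
  shows "prob (surv n \<inter> {\<omega> \<in> space M. x \<le> X i \<omega>}) \<le>
    prob (surv i) * tail ((1 - \<delta>) * \<gamma> * real n) + prob (stray n (\<gamma> * \<delta> / 2) i) * tail x"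
proof -
  let ?b = "(1 - \<delta>) * \<gamma> * real n"
  note [measurable] = jump_measurable[OF i(1)]
  have "surv n \<inter> {\<omega> \<in> space M. x \<le> X i \<omega>} \<subseteq> (surv i \<inter> {\<omega> \<in> space M. ?b \<le> X i \<omega>}) \<union>
      (stray n (\<gamma> * \<delta> / 2) i \<inter> {\<omega> \<in> space M. x \<le> X i \<omega>})"
  proof (rule subsetI, rule ccontr)
    fix \<omega> assume w: "\<omega> \<in> surv n \<inter> {\<omega> \<in> space M. x \<le> X i \<omega>}"
      "\<omega> \<notin> (surv i \<inter> {\<omega> \<in> space M. ?b \<le> X i \<omega>}) \<union> (stray n (\<gamma> * \<delta> / 2) i \<inter> {\<omega> \<in> space M. x \<le> X i \<omega>})"
    then have sp: "\<omega> \<in> space M" and s: "\<omega> \<in> surv n" by auto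
    have "\<omega> \<in> surv i" using s surv_antimono[of i n] i by auto
    then have X: "X i \<omega> < ?b" and st: "\<omega> \<notin> stray n (\<gamma> * \<delta> / 2) i" using w sp by auto
    \<comment> \<open>Survival says nothing about time \<open>n\<close> itself; the lost unit of
      time is absorbed by \<open>2 < \<delta> * real n\<close>.\<close>
    have "n - 1 \<in> {..n}" by simp
    with st sp have "\<bar>(\<Sum>l\<in>{1..n - 1} - {i}. X l \<omega>) + \<gamma> * real (n - 1)\<bar> \<le> \<gamma> * \<delta> / 2 * real n"
      unfolding stray_def by (auto simp: not_less)
    moreover have "(\<Sum>l\<in>{1..n - 1} - {i}. X l \<omega>) = walk X (n - 1) \<omega> - X i \<omega>"
      unfolding walk_without_step[OF i(1)] using i by simp
    moreover have "0 \<le> walk X (n - 1) \<omega>" using s i by (auto simp: surv_eq)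
    ultimately have "\<gamma> * real (n - 1) \<le> \<gamma> * \<delta> / 2 * real n + ?b"
      using X by linarith
    moreover have "real (n - 1) = real n - 1" using i by (simp add: of_nat_diff)
    ultimately have "\<gamma> * (\<delta> * real n) \<le> \<gamma> * 2" by (simp add: algebra_simps)
    then show False using drift n by simp
  qed
  then have "prob (surv n \<inter> {\<omega> \<in> space M. x \<le> X i \<omega>}) \<le> prob ((surv i \<inter> {\<omega> \<in> space M. ?b \<le> X i \<omega>}) \<union>
      (stray n (\<gamma> * \<delta> / 2) i \<inter> {\<omega> \<in> space M. x \<le> X i \<omega>}))"
    by (rule finite_measure_mono) measurable
  also have "\<dots> \<le> prob (surv i \<inter> {\<omega> \<in> space M. ?b \<le> X i \<omega>}) +
      prob (stray n (\<gamma> * \<delta> / 2) i \<inter> {\<omega> \<in> space M. x \<le> X i \<omega>})"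
    by (rule measure_Un_le) measurable
  finally show ?thesis by (simp only: prob_surv_jump[OF i(1)] prob_stray_jump[OF i(1)])
qed

text \<open>Survival happens without a step above \<open>x\<close>, with one at a time up to
  \<open>J\<close>, or with a later one. In the last case only survival up to the jump is kept,
  whose probabilities sum to at most \<open>excess J\<close>.\<close>

lemma prob_surv_le:
  assumes fin: "expected_zeta M X < \<infinity>" and J: "J < n" and n2: "2 \<le> n"
    and \<delta>: "0 < \<delta>" and n: "2 < \<delta> * real n"
  shows "prob (surv n) \<le> prob (surv n \<inter> no_jump n x) + mean_zeta * tail ((1 - \<delta>) * \<gamma> * real n)
    + (\<Sum>i = 1..J. prob (stray n (\<gamma> * \<delta> / 2) i)) * tail x + excess J * tail x"
proof -
  let ?B = "\<lambda>i. surv n \<inter> {\<omega> \<in> space M. x \<le> X i \<omega>}"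
  have B: "?B i \<in> events" if "1 \<le> i" for i using jump_measurable[OF that] by auto
  then have UB: "(\<Union>i\<in>{1..<n}. ?B i) \<in> events" by (intro sets.finite_UN) auto
  have "surv n \<subseteq> (surv n \<inter> no_jump n x) \<union> (\<Union>i\<in>{1..<n}. ?B i)"
    by (auto simp: no_jump_def surv_def not_less)
  then have "prob (surv n) \<le> prob ((surv n \<inter> no_jump n x) \<union> (\<Union>i\<in>{1..<n}. ?B i))"
    by (rule finite_measure_mono) (use UB in auto)
  also have "\<dots> \<le> prob (surv n \<inter> no_jump n x) + prob (\<Union>i\<in>{1..<n}. ?B i)"
    by (rule measure_Un_le) (use UB in auto)
  also have "prob (\<Union>i\<in>{1..<n}. ?B i) \<le> (\<Sum>i\<in>{1..<n}. prob (?B i))"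
    by (rule finite_measure_subadditive_finite) (use B in auto)
  also have "{1..<n} = {1..J} \<union> {J<..<n}" using J by auto
  also have "(\<Sum>i\<in>\<dots>. prob (?B i)) = (\<Sum>i = 1..J. prob (?B i)) + (\<Sum>i\<in>{J<..<n}. prob (?B i))"
    by (rule sum.union_disjoint) auto
  also have "(\<Sum>i = 1..J. prob (?B i)) \<le> (\<Sum>i = 1..J. prob (surv i) * tail ((1 - \<delta>) * \<gamma> * real n)
      + prob (stray n (\<gamma> * \<delta> / 2) i) * tail x)"
    by (rule sum_mono) (use J in \<open>auto intro!: prob_surv_jump_le \<delta> n\<close>)
  also have "\<dots> = (\<Sum>i = 1..J. prob (surv i)) * tail ((1 - \<delta>) * \<gamma> * real n)
      + (\<Sum>i = 1..J. prob (stray n (\<gamma> * \<delta> / 2) i)) * tail x"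
    by (simp add: sum.distrib sum_distrib_right)
  also have "(\<Sum>i = 1..J. prob (surv i)) \<le> mean_zeta"
  proof -
    have "0 \<le> (\<Sum>i\<in>{J<..<n}. prob (surv i))" by (rule sum_nonneg) simp
    with sum_surv_le_excess[OF fin J] show ?thesis by (simp add: excess_def)
  qed
  also have "(\<Sum>i\<in>{J<..<n}. prob (?B i)) \<le> (\<Sum>i\<in>{J<..<n}. prob (surv i) * tail x)"
  proof (rule sum_mono)
    fix i assume i: "i \<in> {J<..<n}"
    then have i1: "1 \<le> i" "i \<le> n" by auto
    have "prob (?B i) \<le> prob (surv i \<inter> {\<omega> \<in> space M. x \<le> X i \<omega>})"
      by (rule finite_measure_mono) (use surv_antimono[OF i1(2)] jump_measurable[OF i1(1)] in auto)
    then show "prob (?B i) \<le> prob (surv i) * tail x" by (simp only: prob_surv_jump[OF i1(1)])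
  qed
  also have "\<dots> = (\<Sum>i\<in>{J<..<n}. prob (surv i)) * tail x"
    by (simp add: sum_distrib_right)
  also have "(\<Sum>i\<in>{J<..<n}. prob (surv i)) \<le> excess J" by (rule sum_surv_le_excess[OF fin J])
  finally show ?thesis by (simp add: tail.tail_nonneg mult_right_mono add_ac)
qed

text \<open>The previous bound is divided by the tail. First \<open>J\<close> is chosen, making the
  late jumps negligible, then \<open>\<delta>\<close>, bringing the early jumps close to
  \<open>mean_zeta\<close>; only then does \<open>n\<close> grow.\<close>

lemma surv_upper:
  assumes fin: "expected_zeta M X < \<infinity>" and \<epsilon>: "\<epsilon> > 0"
  shows "\<forall>\<^sub>F n in sequentially. prob (surv n) \<le> (mean_zeta + \<epsilon>) * tail (\<gamma> * real n)"
proof -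
  obtain \<eta> where \<eta>: "\<eta> > 0" "(\<lambda>n. prob (surv n \<inter> no_jump n (\<eta> * real n)) / tail (\<gamma> * real n)) \<longlonglongrightarrow> 0"
    by (rule no_jump_negligible)
  define c where "c = (\<eta> / \<gamma>) powr - \<beta>"
  have c: "(\<lambda>n. tail (\<eta> * real n) / tail (\<gamma> * real n)) \<longlonglongrightarrow> c"
    unfolding c_def using \<eta>(1) drift by (rule tail.tail_ratio_seq)
  \<comment> \<open>Late jumps only have to exceed \<open>\<eta> * real n\<close>, which is more
    likely than exceeding \<open>\<gamma> * real n\<close> by a factor tending to
    \<open>c\<close>.\<close>
  have "\<forall>\<^sub>F J in sequentially. excess J * c < \<epsilon> / 2"
    using tendsto_mult[OF excess_tendsto[OF fin] tendsto_const[of c]] \<epsilon>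
    by (intro order_tendstoD) auto
  then obtain J where J: "excess J * c < \<epsilon> / 2" by (auto simp: eventually_sequentially)
  have "((\<lambda>\<delta>. mean_zeta * (1 - \<delta>) powr - \<beta>) \<longlongrightarrow> mean_zeta * (1 - 0) powr - \<beta>) (at_right 0)"
    by (intro tendsto_intros) auto
  then have "\<forall>\<^sub>F \<delta> in at_right 0. mean_zeta * (1 - \<delta>) powr - \<beta> < mean_zeta + \<epsilon> / 2"
    using \<epsilon> by (intro order_tendstoD) auto
  moreover have "\<forall>\<^sub>F \<delta> in at_right (0::real). 0 < \<delta> \<and> \<delta> < 1"
    by (auto simp: eventually_at_right_field intro: exI[of _ 1])
  ultimately have "\<forall>\<^sub>F \<delta> in at_right 0. mean_zeta * (1 - \<delta>) powr - \<beta> < mean_zeta + \<epsilon> / 2 \<and> 0 < \<delta> \<and> \<delta> < 1"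
    by eventually_elim auto
  then obtain \<delta> where \<delta>: "mean_zeta * (1 - \<delta>) powr - \<beta> < mean_zeta + \<epsilon> / 2" "0 < \<delta>" "\<delta> < 1"
    using eventually_happens[of _ "at_right (0::real)"] by (auto simp: trivial_limit_at_right_real)
  let ?R = "\<lambda>n. prob (surv n \<inter> no_jump n (\<eta> * real n)) / tail (\<gamma> * real n)
    + mean_zeta * (tail ((1 - \<delta>) * \<gamma> * real n) / tail (\<gamma> * real n))
    + (\<Sum>i = 1..J. prob (stray n (\<gamma> * \<delta> / 2) i)) * (tail (\<eta> * real n) / tail (\<gamma> * real n))
    + excess J * (tail (\<eta> * real n) / tail (\<gamma> * real n))"
  have "?R \<longlonglongrightarrow> 0 + mean_zeta * ((1 - \<delta>) * \<gamma> / \<gamma>) powr - \<beta> + (\<Sum>i = 1..J. 0) * c + excess J * c"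
    by (intro tendsto_add tendsto_mult tendsto_const tendsto_sum \<eta>(2) c prob_stray_tendsto tail.tail_ratio_seq)
       (use drift \<delta> in auto)
  then have "\<forall>\<^sub>F n in sequentially. ?R n < mean_zeta + \<epsilon>"
    by (rule order_tendstoD) (use drift \<delta> J in simp)
  moreover have "\<forall>\<^sub>F n in sequentially. 2 < \<delta> * real n" using \<delta> by real_asymp
  ultimately show ?thesis
    using eventually_gt_at_top[of J] eventually_ge_at_top[of 2]
  proof eventually_elim
    case (elim n)
    have "prob (surv n) / tail (\<gamma> * real n) \<le> ?R n"
      using prob_surv_le[OF fin elim(3,4) \<delta>(2) elim(2), of "\<eta> * real n"] tail.tail_pos[of "\<gamma> * real n"]
      by (simp add: field_simps)
    with elim(1) have "prob (surv n) / tail (\<gamma> * real n) < mean_zeta + \<epsilon>" by linarith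
    then show ?case using tail.tail_pos[of "\<gamma> * real n"] by (simp add: divide_less_eq)
  qed
qed

section \<open>Jump events and their overlap with survival\<close>

definition jump :: "nat \<Rightarrow> nat \<Rightarrow> 'a set" where
  "jump n j = surv j \<inter> {\<omega> \<in> space M. \<gamma> * real n \<le> X j \<omega>}"

lemma jump_events: "1 \<le> j \<Longrightarrow> jump n j \<in> events"
  unfolding jump_def using jump_measurable[of j] by auto

text \<open>Up to the common factor \<open>mean_zeta * tail (\<gamma> * real n)\<close>, these
  events carry the weights of the index \<open>I\<close>.\<close>

lemma prob_jump: "1 \<le> j \<Longrightarrow> prob (jump n j) = prob (surv j) * tail (\<gamma> * real n)"
  unfolding jump_def by (rule prob_surv_jump)

text \<open>If the jump exceeds \<open>(1 + \<delta>) * \<gamma> * real n\<close> and the other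
  steps do not stray, the surplus outweighs the drift up to time \<open>n\<close>; before time
  \<open>j\<close> the walk is nonnegative by \<open>surv j\<close>.\<close>

lemma prob_jump_not_surv_le:
  assumes j: "1 \<le> j" and \<delta>: "0 < \<delta>"
  shows "prob (jump n j - surv n) \<le> tail (\<gamma> * real n) - tail ((1 + \<delta>) * \<gamma> * real n)
    + prob (stray n (\<gamma> * \<delta>) j) * tail (\<gamma> * real n)"
proof -
  let ?g = "\<lambda>x. {\<omega> \<in> space M. x \<le> X j \<omega>}"
  let ?a = "\<gamma> * real n" and ?b = "(1 + \<delta>) * \<gamma> * real n"
  note [measurable] = jump_measurable[OF j]
  have "?a \<le> ?b" using \<delta> drift by (intro mult_right_mono) auto
  have "jump n j - surv n \<subseteq> (?g ?a - ?g ?b) \<union> (stray n (\<gamma> * \<delta>) j \<inter> ?g ?a)"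
  proof (rule subsetI, rule ccontr)
    fix \<omega> assume w: "\<omega> \<in> jump n j - surv n" "\<omega> \<notin> (?g ?a - ?g ?b) \<union> (stray n (\<gamma> * \<delta>) j \<inter> ?g ?a)"
    then have sp: "\<omega> \<in> space M" and s: "\<omega> \<in> surv j" and b: "?b \<le> X j \<omega>" and st: "\<omega> \<notin> stray n (\<gamma> * \<delta>) j"
      by (auto simp: jump_def)
    have "0 \<le> walk X k \<omega>" if k: "k \<in> {1..<n}" for k
    proof (cases "k < j")
      case True
      then show ?thesis using s k by (auto simp: surv_eq)
    next
      case False
      have "k \<in> {..n}" using k by simp
      with st sp have "\<bar>(\<Sum>l\<in>{1..k} - {j}. X l \<omega>) + \<gamma> * real k\<bar> \<le> \<gamma> * \<delta> * real n"
        unfolding stray_def by (auto simp: not_less)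
      moreover have "(\<Sum>l\<in>{1..k} - {j}. X l \<omega>) = walk X k \<omega> - X j \<omega>"
        unfolding walk_without_step[OF j] using False by simp
      moreover have "\<gamma> * real k \<le> \<gamma> * real n" using k drift by simp
      moreover have "?b = \<gamma> * real n + \<gamma> * \<delta> * real n" by (simp add: algebra_simps)
      ultimately show ?thesis using b by linarith
    qed
    then have "\<omega> \<in> surv n" using sp by (auto simp: surv_eq)
    then show False using w by auto
  qed
  then have "prob (jump n j - surv n) \<le> prob ((?g ?a - ?g ?b) \<union> (stray n (\<gamma> * \<delta>) j \<inter> ?g ?a))"
    by (rule finite_measure_mono) measurable
  also have "\<dots> \<le> prob (?g ?a - ?g ?b) + prob (stray n (\<gamma> * \<delta>) j \<inter> ?g ?a)"
    by (rule measure_Un_le) measurable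
  also have "prob (?g ?a - ?g ?b) = prob (?g ?a) - prob (?g ?b)"
    using \<open>?a \<le> ?b\<close> by (intro finite_measure_Diff) (auto intro: jump_measurable[OF j])
  finally show ?thesis by (simp only: tail_step[OF j] prob_stray_jump[OF j])
qed

text \<open>Relative to the tail, the bound tends to
  \<open>1 - (1 + \<delta>) powr - \<beta>\<close>, which is small for small
  \<open>\<delta>\<close>.\<close>

lemma jump_not_surv_tendsto:
  assumes j: "1 \<le> j"
  shows "(\<lambda>n. prob (jump n j - surv n) / tail (\<gamma> * real n)) \<longlonglongrightarrow> 0"
proof (rule order_tendstoI)
  fix \<epsilon> :: real assume \<epsilon>: "0 < \<epsilon>"
  have "((\<lambda>\<delta>. 1 - (1 + \<delta>) powr - \<beta>) \<longlongrightarrow> 1 - (1 + 0) powr - \<beta>) (at_right 0)"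
    by (intro tendsto_intros) auto
  then have "\<forall>\<^sub>F \<delta> in at_right 0. 1 - (1 + \<delta>) powr - \<beta> < \<epsilon>"
    using \<epsilon> by (intro order_tendstoD) auto
  moreover have "\<forall>\<^sub>F \<delta> in at_right (0::real). 0 < \<delta>"
    by (rule eventually_at_right_less)
  ultimately have "\<forall>\<^sub>F \<delta> in at_right 0. 1 - (1 + \<delta>) powr - \<beta> < \<epsilon> \<and> 0 < \<delta>"
    by eventually_elim auto
  then obtain \<delta> where \<delta>: "1 - (1 + \<delta>) powr - \<beta> < \<epsilon>" "0 < \<delta>"
    using eventually_happens[of _ "at_right (0::real)"] by (auto simp: trivial_limit_at_right_real)
  let ?R = "\<lambda>n. 1 - tail ((1 + \<delta>) * \<gamma> * real n) / tail (\<gamma> * real n) + prob (stray n (\<gamma> * \<delta>) j)"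
  have "?R \<longlonglongrightarrow> 1 - ((1 + \<delta>) * \<gamma> / \<gamma>) powr - \<beta> + 0"
    by (intro tendsto_intros prob_stray_tendsto tail.tail_ratio_seq) (use drift \<delta> j in auto)
  then have "\<forall>\<^sub>F n in sequentially. ?R n < \<epsilon>"
    by (rule order_tendstoD) (use drift \<delta> in simp)
  then show "\<forall>\<^sub>F n in sequentially. prob (jump n j - surv n) / tail (\<gamma> * real n) < \<epsilon>"
  proof eventually_elim
    case (elim n)
    have "prob (jump n j - surv n) / tail (\<gamma> * real n) \<le> ?R n"
      using prob_jump_not_surv_le[OF j \<delta>(2), of n] tail.tail_pos[of "\<gamma> * real n"]
      by (simp add: field_simps)
    with elim show ?case by linarith
  qed
next
  fix \<epsilon> :: real assume \<epsilon>: "\<epsilon> < 0"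
  have "0 \<le> prob (jump n j - surv n) / tail (\<gamma> * real n)" for n
    by (simp add: tail.tail_nonneg)
  then show "\<forall>\<^sub>F n in sequentially. \<epsilon> < prob (jump n j - surv n) / tail (\<gamma> * real n)"
    using \<epsilon> by (intro always_eventually allI) (rule less_le_trans)
qed

text \<open>Within survival the jump events are nearly disjoint: each overlap needs two large steps.
  Both error terms are independent of \<open>E\<close>, which is the source of uniformity in total
  variation.\<close>

lemma sum_prob_jump_le:
  assumes E: "E \<in> events"
  shows "(\<Sum>j = 1..J. prob (E \<inter> jump n j)) \<le>
    prob (E \<inter> surv n) + (\<Sum>j = 1..J. prob (jump n j - surv n)) + (real J)\<^sup>2 * (tail (\<gamma> * real n))\<^sup>2"
proof -
  let ?p = "(tail (\<gamma> * real n))\<^sup>2"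
  \<comment> \<open>The empty set at index \<open>0\<close> makes every \<open>B j\<close>
    measurable, as nothing is known about \<open>X 0\<close>.\<close>
  define B where "B j = (if 1 \<le> j then E \<inter> surv n \<inter> jump n j else {})" for j
  have B: "B j \<in> events" for j using E jump_events[of j n] by (auto simp: B_def)
  have "prob (E \<inter> jump n j) \<le> prob (B j) + prob (jump n j - surv n)" if "j \<in> {1..J}" for j
  proof -
    have j: "1 \<le> j" using that by simp
    have "prob (E \<inter> jump n j) \<le> prob (B j \<union> (jump n j - surv n))"
      by (rule finite_measure_mono) (use B[of j] jump_events[OF j, of n] j in \<open>auto simp: B_def\<close>)
    also have "\<dots> \<le> prob (B j) + prob (jump n j - surv n)"
      by (rule measure_Un_le) (use B[of j] jump_events[OF j, of n] in auto)
    finally show ?thesis .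
  qed
  then have "(\<Sum>j = 1..J. prob (E \<inter> jump n j)) \<le> (\<Sum>j = 1..J. prob (B j)) + (\<Sum>j = 1..J. prob (jump n j - surv n))"
    unfolding sum.distrib[symmetric] by (rule sum_mono)
  moreover have "(\<Sum>j = 1..J. prob (B j)) \<le> prob (\<Union>j\<in>{1..J}. B j) + (\<Sum>j = 1..J. \<Sum>i = 1..<j. prob (B i \<inter> B j))"
    by (rule bonferroni_lower[OF B])
  moreover have "prob (\<Union>j\<in>{1..J}. B j) \<le> prob (E \<inter> surv n)"
    by (rule finite_measure_mono) (use E in \<open>auto simp: B_def\<close>)
  moreover have "(\<Sum>j = 1..J. \<Sum>i = 1..<j. prob (B i \<inter> B j)) \<le> (\<Sum>j = 1..J. \<Sum>i = 1..J. ?p)"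
  proof (rule sum_mono)
    fix j assume j: "j \<in> {1..J}"
    have "(\<Sum>i = 1..<j. prob (B i \<inter> B j)) \<le> (\<Sum>i = 1..<j. ?p)"
    proof (rule sum_mono)
      fix i assume i: "i \<in> {1..<j}"
      let ?g = "\<lambda>i. {\<omega> \<in> space M. \<gamma> * real n \<le> X i \<omega>}"
      have "prob (B i \<inter> B j) \<le> prob (?g i \<inter> ?g j)"
        by (rule finite_measure_mono) (use i j jump_measurable in \<open>auto simp: B_def jump_def\<close>)
      also have "\<dots> = ?p" by (rule prob_two_jumps) (use i in auto)
      finally show "prob (B i \<inter> B j) \<le> ?p" .
    qed
    also have "\<dots> \<le> (\<Sum>i = 1..J. ?p)"
      by (rule sum_mono2) (use j in auto)
    finally show "(\<Sum>i = 1..<j. prob (B i \<inter> B j)) \<le> (\<Sum>i = 1..J. ?p)" .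
  qed
  moreover have "(\<Sum>j = 1..J. \<Sum>i = 1..J. ?p) = (real J)\<^sup>2 * ?p"
    by (simp add: power2_eq_square)
  ultimately show ?thesis by linarith
qed

lemma summable_prob_jump:
  assumes fin: "expected_zeta M X < \<infinity>" and E: "E \<in> events"
  shows "summable (\<lambda>j. prob (E \<inter> jump n (Suc j)))"
proof (rule summable_comparison_test')
  show "summable (\<lambda>j. prob (surv (Suc j)) * tail (\<gamma> * real n))"
    using surv_sums[OF fin] by (intro summable_mult2) (simp add: sums_iff)
  show "norm (prob (E \<inter> jump n (Suc j))) \<le> prob (surv (Suc j)) * tail (\<gamma> * real n)" if "0 \<le> j" for j
    using prob_jump[of "Suc j" n] jump_events[of "Suc j" n]
    by (simp add: One_nat_def) (metis finite_measure_mono inf_le2)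
qed

text \<open>The left side will be the law of the big-jump process and the right side the conditioned
  law, evaluated at the same path event.\<close>

lemma jump_mixture_le:
  assumes fin: "expected_zeta M X < \<infinity>" and \<epsilon>: "\<epsilon> > 0"
  shows "\<forall>\<^sub>F n in sequentially. \<forall>E\<in>events.
    (\<Sum>j. prob (E \<inter> jump n (Suc j))) / (mean_zeta * tail (\<gamma> * real n)) \<le> prob (E \<inter> surv n) / prob (surv n) + \<epsilon>"
proof -
  have a: "mean_zeta > 0" using mean_zeta_ge_1[OF fin] by simp
  \<comment> \<open>Three errors are to be absorbed: the late jumps, the early jumps, and the gap in
    \<open>surv_upper\<close>.\<close>
  define \<epsilon>' where "\<epsilon>' = mean_zeta * \<epsilon> / 3"
  have \<epsilon>': "\<epsilon>' > 0" using a \<epsilon> by (simp add: \<epsilon>'_def)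
  have "\<forall>\<^sub>F J in sequentially. excess J < \<epsilon>'"
    using excess_tendsto[OF fin] \<epsilon>' by (rule order_tendstoD)
  then obtain J where J: "excess J < \<epsilon>'" by (auto simp: eventually_sequentially)
  let ?R = "\<lambda>n. (\<Sum>j = 1..J. prob (jump n j - surv n) / tail (\<gamma> * real n)) + (real J)\<^sup>2 * tail (\<gamma> * real n)"
  have "?R \<longlonglongrightarrow> (\<Sum>j = 1..J. 0) + (real J)\<^sup>2 * 0"
    by (intro tendsto_add tendsto_mult tendsto_const tendsto_sum jump_not_surv_tendsto tail_seq_tendsto) auto
  then have "\<forall>\<^sub>F n in sequentially. ?R n < \<epsilon>'"
    by (rule order_tendstoD) (use \<epsilon>' in simp)
  then show ?thesis
    using surv_upper[OF fin \<epsilon>']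
  proof eventually_elim
    case (elim n)
    let ?p = "tail (\<gamma> * real n)"
    have p: "0 < ?p" by (rule tail.tail_pos)
    show ?case
    proof
      fix E assume E: "E \<in> events"
      \<comment> \<open>Writing the probability of \<open>E \<inter> surv n\<close> as
        \<open>u * prob (surv n)\<close> lets the upper bound for survival act on it, with an error
        at most \<open>\<epsilon>' * ?p\<close> because \<open>u \<le> 1\<close>.\<close>
      define u where "u = prob (E \<inter> surv n) / prob (surv n)"
      have "0 \<le> u" by (simp add: u_def)
      have "u \<le> 1"
        using surv_pos[of n] finite_measure_mono[of "E \<inter> surv n" "surv n"] by (simp add: u_def)
      have sm: "summable (\<lambda>j. prob (E \<inter> jump n (Suc j)))" by (rule summable_prob_jump[OF fin E])
      have "(\<Sum>j. prob (E \<inter> jump n (Suc j))) = (\<Sum>j. prob (E \<inter> jump n (Suc (j + J)))) + (\<Sum>j<J. prob (E \<inter> jump n (Suc j)))"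
        by (rule suminf_split_initial_segment[OF sm])
      also have "(\<Sum>j. prob (E \<inter> jump n (Suc (j + J)))) \<le> (\<Sum>j. prob (surv (Suc (j + J))) * ?p)"
      proof (rule suminf_le)
        show "summable (\<lambda>j. prob (E \<inter> jump n (Suc (j + J))))"
          using sm by (rule summable_ignore_initial_segment)
        show "summable (\<lambda>j. prob (surv (Suc (j + J))) * ?p)"
          using surv_sums[OF fin] by (intro summable_mult2 summable_ignore_initial_segment) (simp add: sums_iff)
        show "prob (E \<inter> jump n (Suc (j + J))) \<le> prob (surv (Suc (j + J))) * ?p" for j
          using prob_jump[of "Suc (j + J)" n] jump_events[of "Suc (j + J)" n]
          by (simp add: One_nat_def) (metis finite_measure_mono inf_le2)
      qed
      also have "(\<Sum>j. prob (surv (Suc (j + J))) * ?p) = (\<Sum>j. prob (surv (Suc (j + J)))) * ?p"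
        using surv_sums[OF fin]
        by (intro suminf_mult2[symmetric] summable_ignore_initial_segment) (simp add: sums_iff)
      also have "(\<Sum>j. prob (surv (Suc (j + J)))) = excess J"
        using suminf_minus_initial_segment[of "\<lambda>j. prob (surv (Suc j))" J] surv_sums[OF fin]
        by (simp add: sums_iff excess_def sum_lessThan_Suc_shift[of "\<lambda>i. prob (surv i)"])
      also have "(\<Sum>j<J. prob (E \<inter> jump n (Suc j))) = (\<Sum>j = 1..J. prob (E \<inter> jump n j))"
        by (rule sum_lessThan_Suc_shift)
      also have "\<dots> \<le> prob (E \<inter> surv n) + (\<Sum>j = 1..J. prob (jump n j - surv n)) + (real J)\<^sup>2 * ?p\<^sup>2"
        by (rule sum_prob_jump_le[OF E])
      finally have "(\<Sum>j. prob (E \<inter> jump n (Suc j))) \<le>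
        excess J * ?p + (prob (E \<inter> surv n) + (\<Sum>j = 1..J. prob (jump n j - surv n)) + (real J)\<^sup>2 * ?p\<^sup>2)"
        by simp
      moreover have "(\<Sum>j = 1..J. prob (jump n j - surv n)) + (real J)\<^sup>2 * ?p\<^sup>2 = ?R n * ?p"
        using p by (simp add: sum_divide_distrib[symmetric] field_simps power2_eq_square)
      moreover have "prob (E \<inter> surv n) = u * prob (surv n)" using surv_pos[of n] by (simp add: u_def)
      ultimately have "(\<Sum>j. prob (E \<inter> jump n (Suc j))) \<le> excess J * ?p + (u * prob (surv n) + ?R n * ?p)"
        by linarith
      also have "\<dots> \<le> \<epsilon>' * ?p + (u * ((mean_zeta + \<epsilon>') * ?p) + \<epsilon>' * ?p)"
        using elim J p \<open>0 \<le> u\<close> by (intro add_mono mult_right_mono mult_left_mono) auto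
      also have "\<dots> = (u * mean_zeta + u * \<epsilon>' + 2 * \<epsilon>') * ?p" by (simp add: algebra_simps)
      also have "\<dots> \<le> (u * mean_zeta + 3 * \<epsilon>') * ?p"
      proof -
        have "u * \<epsilon>' \<le> 1 * \<epsilon>'" using \<open>u \<le> 1\<close> \<epsilon>' by (intro mult_right_mono) auto
        then show ?thesis using p by (intro mult_right_mono) auto
      qed
      also have "\<dots> = (u + \<epsilon>) * (mean_zeta * ?p)" by (simp add: \<epsilon>'_def algebra_simps)
      finally show "(\<Sum>j. prob (E \<inter> jump n (Suc j))) / (mean_zeta * ?p) \<le> prob (E \<inter> surv n) / prob (surv n) + \<epsilon>"
        unfolding u_def[symmetric] using a p by (simp only: pos_divide_le_eq mult_pos_pos)
    qed
  qed
qed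

end

subsection \<open>The law of the big-jump process\<close>

text \<open>Measurable boxes form an intersection-stable generator containing the whole space, so
  finite measures agreeing on them coincide.\<close>

lemma measure_eqI_triple:
  assumes P: "sets P = sets (K1 \<Otimes>\<^sub>M (K2 \<Otimes>\<^sub>M K3))" and Q: "sets Q = sets (K1 \<Otimes>\<^sub>M (K2 \<Otimes>\<^sub>M K3))"
    and fin: "emeasure P (space P) \<noteq> \<infinity>"
    and eq: "\<And>A B C. A \<in> sets K1 \<Longrightarrow> B \<in> sets K2 \<Longrightarrow> C \<in> sets K3 \<Longrightarrow>
      emeasure P (A \<times> (B \<times> C)) = emeasure Q (A \<times> (B \<times> C))"
  shows "P = Q"
proof -
  let ?E' = "{a \<times> b | a b. a \<in> sets K2 \<and> b \<in> sets K3}"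
  let ?E = "{a \<times> b | a b. a \<in> sets K1 \<and> b \<in> ?E'}"
  let ?\<Omega> = "space K1 \<times> (space K2 \<times> space K3)"
  have sub': "?E' \<subseteq> Pow (space K2 \<times> space K3)"
    using sets.sets_into_space[of _ K2] sets.sets_into_space[of _ K3] by blast
  have sub: "?E \<subseteq> Pow ?\<Omega>"
    using sets.sets_into_space[of _ K1] sub' by blast
  have "sets (K1 \<Otimes>\<^sub>M (K2 \<Otimes>\<^sub>M K3)) = sets (sigma (space K1 \<times> space (K2 \<Otimes>\<^sub>M K3)) ?E)"
  proof (rule sets_pair_eq[where Ca = "{space K1}" and Cb = "{space K2 \<times> space K3}"])
    show "sets (K2 \<Otimes>\<^sub>M K3) = sigma_sets (space (K2 \<Otimes>\<^sub>M K3)) ?E'"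
      by (simp add: sets_pair_measure space_pair_measure)
    show "?E' \<subseteq> Pow (space (K2 \<Otimes>\<^sub>M K3))"
      using sub' by (simp add: space_pair_measure)
  qed (auto simp: space_pair_measure sets.sigma_sets_eq dest: sets.sets_into_space)
  also have "\<dots> = sigma_sets ?\<Omega> ?E"
    using sub by (simp add: space_pair_measure)
  finally have gen: "sets (K1 \<Otimes>\<^sub>M (K2 \<Otimes>\<^sub>M K3)) = sigma_sets ?\<Omega> ?E" .
  show ?thesis
  proof (rule measure_eqI_generator_eq[where E = ?E and \<Omega> = ?\<Omega> and A = "\<lambda>_. ?\<Omega>"])
    show "Int_stable ?E"
    proof (rule Int_stableI)
      fix a b assume "a \<in> ?E" "b \<in> ?E"
      then obtain a1 a2 a3 b1 b2 b3 where "a = a1 \<times> (a2 \<times> a3)" "b = b1 \<times> (b2 \<times> b3)"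
        "a1 \<in> sets K1" "a2 \<in> sets K2" "a3 \<in> sets K3" "b1 \<in> sets K1" "b2 \<in> sets K2" "b3 \<in> sets K3"
        by blast
      then have "a \<inter> b = (a1 \<inter> b1) \<times> ((a2 \<inter> b2) \<times> (a3 \<inter> b3))"
        "a1 \<inter> b1 \<in> sets K1" "a2 \<inter> b2 \<in> sets K2" "a3 \<inter> b3 \<in> sets K3"
        by auto
      then show "a \<inter> b \<in> ?E" by blast
    qed
    show "?E \<subseteq> Pow ?\<Omega>" by (rule sub)
    show "emeasure P A = emeasure Q A" if "A \<in> ?E" for A
      using that eq by blast
    show "sets P = sigma_sets ?\<Omega> ?E" "sets Q = sigma_sets ?\<Omega> ?E"
      using P Q gen by auto
    show "range (\<lambda>_. ?\<Omega>) \<subseteq> ?E" by auto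
    have "space P = ?\<Omega>" using sets_eq_imp_space_eq[OF P] by (simp add: space_pair_measure)
    then show "emeasure P ?\<Omega> \<noteq> \<infinity>" using fin by simp
  qed simp
qed

text \<open>Left inverse of cutting a path at \<open>j \<ge> 1\<close> into prefix, jump and later
  increments; the jump is added to the last prefix value \<open>u (j - 1)\<close>.\<close>

definition rebuild :: "nat \<Rightarrow> (nat \<Rightarrow> real) \<times> real \<times> (nat \<Rightarrow> real) \<Rightarrow> nat \<Rightarrow> real" where
  "rebuild j = (\<lambda>(u, y, v) i. if i < j then u i else u (j - 1) + y + v (i - j))"

abbreviation prefix_space :: "nat \<Rightarrow> (nat \<Rightarrow> real) measure" where
  "prefix_space j \<equiv> PiM {..<j} (\<lambda>_. borel)"

abbreviation segments :: "(nat \<Rightarrow> 'a \<Rightarrow> real) \<Rightarrow> nat \<Rightarrow> 'a \<Rightarrow> (nat \<Rightarrow> real) \<times> real \<times> (nat \<Rightarrow> real)" where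
  "segments Y j \<equiv> (\<lambda>\<omega>. (\<lambda>i\<in>{..<j}. Y i \<omega>, Y j \<omega> - Y (j - 1) \<omega>, \<lambda>i. Y (i + j) \<omega> - Y j \<omega>))"

lemma rebuild_segments:
  assumes "1 \<le> j"
  shows "rebuild j (segments Y j \<omega>) = (\<lambda>i. Y i \<omega>)"
  using assms by (auto simp: rebuild_def fun_eq_iff)

lemma rebuild_measurable:
  assumes "1 \<le> j"
  shows "rebuild j \<in> measurable (prefix_space j \<Otimes>\<^sub>M (borel \<Otimes>\<^sub>M borel)) borel"
proof (rule measurable_coordinatewise_then_product)
  fix i
  have v: "(\<lambda>v :: nat \<Rightarrow> real. v k) \<in> borel_measurable borel" for k
    by (rule borel_measurable_continuous_onI) (rule continuous_on_product_coordinates)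
  have [measurable]: "(\<lambda>x. snd (snd x) (i - j)) \<in> borel_measurable (prefix_space j \<Otimes>\<^sub>M (borel \<Otimes>\<^sub>M (borel :: (nat \<Rightarrow> real) measure)))"
    by (rule measurable_compose[OF _ v]) measurable
  have u: "(\<lambda>x. fst x k) \<in> borel_measurable (prefix_space j \<Otimes>\<^sub>M (borel \<Otimes>\<^sub>M (borel :: (nat \<Rightarrow> real) measure)))"
    if "k < j" for k
    using that by (intro measurable_compose[OF measurable_fst measurable_component_singleton]) auto
  have [measurable]: "(\<lambda>x. fst x (j - 1)) \<in> borel_measurable (prefix_space j \<Otimes>\<^sub>M (borel \<Otimes>\<^sub>M (borel :: (nat \<Rightarrow> real) measure)))"
    by (rule u) (use assms in simp)
  have "(\<lambda>x. rebuild j x i) = (if i < j then (\<lambda>x. fst x i) else (\<lambda>x. fst x (j - 1) + fst (snd x) + snd (snd x) (i - j)))"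
    by (auto simp: rebuild_def fun_eq_iff split: prod.split)
  also have "\<dots> \<in> borel_measurable (prefix_space j \<Otimes>\<^sub>M (borel \<Otimes>\<^sub>M (borel :: (nat \<Rightarrow> real) measure)))"
    using u[of i] by auto
  finally show "(\<lambda>x. rebuild j x i) \<in> borel_measurable (prefix_space j \<Otimes>\<^sub>M (borel \<Otimes>\<^sub>M borel))" .
qed

lemma path_measurable:
  fixes Y :: "nat \<Rightarrow> 'a \<Rightarrow> real"
  shows "(\<And>i. Y i \<in> borel_measurable M) \<Longrightarrow> (\<lambda>\<omega> i. Y i \<omega>) \<in> borel_measurable M"
  by (rule measurable_coordinatewise_then_product)

lemma segments_measurable:
  assumes [measurable]: "\<And>i. Y i \<in> borel_measurable M"
  shows "segments Y j \<in> measurable M (prefix_space j \<Otimes>\<^sub>M (borel \<Otimes>\<^sub>M borel))"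
  by (intro measurable_Pair measurable_restrict measurable_coordinatewise_then_product) measurable

text \<open>The path is a measurable function of its three segments, so their joint law, tested on
  boxes, determines the path law.\<close>

lemma path_law_eqI:
  assumes j: "1 \<le> j" and P: "prob_space P" and Q: "prob_space Q"
    and Y: "\<And>i. Y i \<in> borel_measurable P" and W: "\<And>i. W i \<in> borel_measurable Q"
    and eq: "\<And>A B C. A \<in> sets (prefix_space j) \<Longrightarrow> B \<in> sets borel \<Longrightarrow> C \<in> sets borel \<Longrightarrow>
      measure P {\<omega> \<in> space P. segments Y j \<omega> \<in> A \<times> B \<times> C} = measure Q {\<omega> \<in> space Q. segments W j \<omega> \<in> A \<times> B \<times> C}"
  shows "path_law P Y = path_law Q W"
proof -
  interpret P: prob_space P by fact
  interpret Q: prob_space Q by fact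
  let ?K = "prefix_space j \<Otimes>\<^sub>M (borel \<Otimes>\<^sub>M (borel :: (nat \<Rightarrow> real) measure))"
  note [measurable] = segments_measurable[where Y = Y and M = P, OF Y] segments_measurable[where Y = W and M = Q, OF W]
  have "distr P ?K (segments Y j) = distr Q ?K (segments W j)"
  proof (rule measure_eqI_triple)
    interpret D: prob_space "distr P ?K (segments Y j)" by (rule P.prob_space_distr) measurable
    show "emeasure (distr P ?K (segments Y j)) (space (distr P ?K (segments Y j))) \<noteq> \<infinity>"
      using D.emeasure_space_1 by simp
    fix A B C assume ABC: "A \<in> sets (prefix_space j)" "B \<in> sets (borel :: real measure)" "C \<in> sets (borel :: (nat \<Rightarrow> real) measure)"
    then show "emeasure (distr P ?K (segments Y j)) (A \<times> B \<times> C) = emeasure (distr Q ?K (segments W j)) (A \<times> B \<times> C)"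
      using eq[OF ABC] by (simp add: emeasure_distr P.emeasure_eq_measure Q.emeasure_eq_measure vimage_def Int_def conj_commute)
  qed simp_all
  then have "distr (distr P ?K (segments Y j)) borel (rebuild j) = distr (distr Q ?K (segments W j)) borel (rebuild j)"
    by simp
  then show ?thesis
    unfolding path_law_def
    by (simp add: distr_distr rebuild_measurable[OF j] comp_def rebuild_segments[OF j])
qed

lemma indep_three_prob:
  assumes P: "prob_space P" and ind: "indep_three P K1 f1 K2 f2 K3 f3"
    and A: "A \<in> sets K1" "B \<in> sets K2" "C \<in> sets K3"
  shows "measure P {\<omega> \<in> space P. f1 \<omega> \<in> A \<and> f2 \<omega> \<in> B \<and> f3 \<omega> \<in> C} =
    measure (distr P K1 f1) A * measure (distr P K2 f2) B * measure (distr P K3 f3) C"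
proof -
  interpret prob_space P by fact
  have f [measurable]: "f1 \<in> measurable P K1" "f2 \<in> measurable P K2" "f3 \<in> measurable P K3"
    and i: "indep_sets (\<lambda>k. [sigma_of P f1 K1, sigma_of P f2 K2, sigma_of P f3 K3] ! k) {0, 1, 2 :: nat}"
    using ind by (auto simp: indep_three_def)
  let ?S = "\<lambda>k. [f1 -` A \<inter> space P, f2 -` B \<inter> space P, f3 -` C \<inter> space P] ! k"
  have "prob (\<Inter>k\<in>{0, 1, 2}. ?S k) = (\<Prod>k\<in>{0, 1, 2}. prob (?S k))"
    by (rule indep_setsD[OF i]) (use A in \<open>auto simp: sigma_of_def One_nat_def intro!: in_vimage_algebra\<close>)
  also have "(\<Inter>k\<in>{0, 1, 2}. ?S k) = {\<omega> \<in> space P. f1 \<omega> \<in> A \<and> f2 \<omega> \<in> B \<and> f3 \<omega> \<in> C}"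
    by (auto simp: One_nat_def)
  also have "(\<Prod>k\<in>{0, 1, 2}. prob (?S k)) = measure (distr P K1 f1) A * measure (distr P K2 f2) B * measure (distr P K3 f3) C"
    using A by (simp add: measure_distr One_nat_def)
  finally show ?thesis .
qed

section \<open>Cutting the random walk at a fixed time\<close>

context drift_walk
begin

text \<open>Reindexing an i.i.d. family along an injection preserves the product law, which
  therefore does not depend on the shift \<open>j\<close>.\<close>

lemma steps_law:
  "distr M (PiM UNIV (\<lambda>_. borel)) (\<lambda>\<omega> i. X (i + Suc j) \<omega>) = PiM UNIV (\<lambda>_. distr M borel (X 1))"
proof -
  let ?D = "distr M borel (X 1)"
  have "distr M (PiM {1..} (\<lambda>_. borel)) (\<lambda>\<omega>. \<lambda>i\<in>{1..}. X i \<omega>) = PiM {1..} (\<lambda>i. distr M borel (X i))"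
    by (subst indep_vars_iff_distr_eq_PiM'[symmetric]) (auto intro: step_measurable indep)
  also have "\<dots> = PiM {1..} (\<lambda>_. ?D)"
    by (rule PiM_cong) (auto intro: ident)
  finally have D: "distr M (PiM {1..} (\<lambda>_. borel)) (\<lambda>\<omega>. \<lambda>i\<in>{1..}. X i \<omega>) = PiM {1..} (\<lambda>_. ?D)" .
  have "PiM UNIV (\<lambda>_. ?D) = distr (PiM {1..} (\<lambda>_. ?D)) (PiM UNIV (\<lambda>_. ?D)) (\<lambda>x. \<lambda>i\<in>UNIV. x (i + Suc j))"
    by (rule distr_PiM_reindex[symmetric]) (auto simp: inj_on_def intro: prob_space_distr)
  also have "\<dots> = distr M (PiM UNIV (\<lambda>_. ?D)) ((\<lambda>x. \<lambda>i\<in>UNIV. x (i + Suc j)) \<circ> (\<lambda>\<omega>. \<lambda>i\<in>{1..}. X i \<omega>))"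
    unfolding D[symmetric]
    by (rule distr_distr)
      (auto intro!: measurable_restrict step_measurable measurable_component_singleton)
  also have "\<dots> = distr M (PiM UNIV (\<lambda>_. borel)) (\<lambda>\<omega> i. X (i + Suc j) \<omega>)"
    by (rule distr_cong) (auto intro!: sets_PiM_cong)
  finally show ?thesis by simp
qed

lemma walk_increment: "walk X (i + j) \<omega> - walk X j \<omega> = (\<Sum>k<i. X (k + Suc j) \<omega>)"
  by (induction i) (simp_all add: walk_def)

text \<open>The increments after any time are the same partial-sum map \<open>G\<close> applied to
  steps with the same product law; shift \<open>0\<close> gives the walk itself.\<close>

lemma shifted_walk_law: "path_law M (\<lambda>i \<omega>. walk X (i + j) \<omega> - walk X j \<omega>) = path_law M (walk X)"
proof -
  define G :: "(nat \<Rightarrow> real) \<Rightarrow> nat \<Rightarrow> real" where "G x i = (\<Sum>k<i. x k)" for x i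
  have G: "G \<in> measurable (PiM UNIV (\<lambda>_. borel)) borel"
    unfolding G_def by (intro measurable_coordinatewise_then_product borel_measurable_sum measurable_component_singleton) auto
  have m: "(\<lambda>\<omega> i. X (i + Suc m) \<omega>) \<in> measurable M (PiM UNIV (\<lambda>_. borel))" for m
    by (intro measurable_PiM_single') (auto intro!: step_measurable)
  have "path_law M (\<lambda>i \<omega>. walk X (i + m) \<omega> - walk X m \<omega>) = distr (PiM UNIV (\<lambda>_. distr M borel (X 1))) borel G" for m
    unfolding steps_law[of m, symmetric] path_law_def walk_increment
    by (subst distr_distr[OF G m]) (auto intro!: distr_cong simp: G_def fun_eq_iff)
  moreover have "walk X 0 \<omega> = 0" for \<omega> by (simp add: walk_def)
  ultimately show ?thesis by (metis (no_types, lifting) add_0_right diff_zero ext)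
qed

text \<open>The three segments depend on the steps before, at and after \<open>j\<close>, which are
  independent blocks \<open>K 0\<close>, \<open>K 1\<close> and \<open>K 2\<close>.\<close>

lemma walk_segments_prob:
  assumes j: "1 \<le> j" and A: "A \<in> sets (prefix_space j)" and B: "B \<in> sets borel" and C: "C \<in> sets borel"
  shows "prob {\<omega> \<in> space M. segments (walk X) j \<omega> \<in> A \<times> B \<times> C} =
    prob {\<omega> \<in> space M. (\<lambda>i\<in>{..<j}. walk X i \<omega>) \<in> A} * prob {\<omega> \<in> space M. X 1 \<omega> \<in> B} *
    measure (path_law M (walk X)) C"
proof -
  define K where "K l = (if l = 0 then {1..<j} else if l = 1 then {j} else {j<..})" for l :: nat
  let ?P = "\<lambda>l. PiM (K l) (\<lambda>_. borel :: real measure)"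
  let ?R = "\<lambda>l \<omega>. \<lambda>k\<in>K l. X k \<omega>"
  define F1 :: "(nat \<Rightarrow> real) \<Rightarrow> nat \<Rightarrow> real" where "F1 x = (\<lambda>i\<in>{..<j}. \<Sum>k = 1..i. x k)" for x
  define F3 :: "(nat \<Rightarrow> real) \<Rightarrow> nat \<Rightarrow> real" where "F3 x i = (\<Sum>k<i. x (k + Suc j))" for x i
  have F1: "F1 \<in> measurable (?P 0) (prefix_space j)"
    unfolding F1_def by (intro measurable_restrict borel_measurable_sum measurable_component_singleton) (auto simp: K_def)
  have F2: "(\<lambda>x. x j) \<in> measurable (?P 1) borel"
    by (intro measurable_component_singleton) (simp add: K_def)
  have F3: "F3 \<in> measurable (?P 2) borel"
    unfolding F3_def by (intro measurable_coordinatewise_then_product borel_measurable_sum measurable_component_singleton) (auto simp: K_def)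
  let ?S = "\<lambda>l. [F1 -` A \<inter> space (?P 0), (\<lambda>x. x j) -` B \<inter> space (?P 1), F3 -` C \<inter> space (?P 2)] ! l"
  let ?T = "\<lambda>l. ?R l -` ?S l \<inter> space M"
  have "indep_vars ?P ?R {0, 1, 2}"
    by (rule indep_vars_restrict[OF indep]) (use j in \<open>auto simp: K_def disjoint_family_on_def\<close>)
  then have "prob (\<Inter>l\<in>{0, 1, 2}. ?T l) = (\<Prod>l\<in>{0, 1, 2}. prob (?T l))"
    by (rule indep_varsD) (use measurable_sets[OF F1 A] measurable_sets[OF F2 B] measurable_sets[OF F3 C] in \<open>auto simp: One_nat_def\<close>)
  also have "(\<Inter>l\<in>{0, 1, 2}. ?T l) = ?T 0 \<inter> ?T 1 \<inter> ?T 2" by blast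
  also have "(\<Prod>l\<in>{0, 1, 2}. prob (?T l)) = prob (?T 0) * prob (?T 1) * prob (?T 2)"
    by (simp del: nth_Cons_numeral nth_Cons_0)
  also have S0: "?R 0 -` ?S 0 \<inter> space M = {\<omega> \<in> space M. (\<lambda>i\<in>{..<j}. walk X i \<omega>) \<in> A}"
  proof -
    have "F1 (?R 0 \<omega>) = (\<lambda>i\<in>{..<j}. walk X i \<omega>)" for \<omega>
      by (auto simp: F1_def walk_def K_def fun_eq_iff intro!: sum.cong)
    then show ?thesis by (auto simp: space_PiM)
  qed
  also have S1: "?R 1 -` ?S 1 \<inter> space M = {\<omega> \<in> space M. X j \<omega> \<in> B}"
    by (auto simp: space_PiM K_def One_nat_def)
  also have S2: "?R 2 -` ?S 2 \<inter> space M = {\<omega> \<in> space M. (\<lambda>i. walk X (i + j) \<omega> - walk X j \<omega>) \<in> C}"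
  proof -
    have "F3 (?R 2 \<omega>) = (\<lambda>i. walk X (i + j) \<omega> - walk X j \<omega>)" for \<omega>
      unfolding walk_increment by (auto simp: F3_def K_def fun_eq_iff intro!: sum.cong)
    then show ?thesis by (auto simp: space_PiM)
  qed
  also have "prob {\<omega> \<in> space M. (\<lambda>i. walk X (i + j) \<omega> - walk X j \<omega>) \<in> C} = measure (path_law M (walk X)) C"
  proof -
    have "measure (path_law M (\<lambda>i \<omega>. walk X (i + j) \<omega> - walk X j \<omega>)) C
        = prob {\<omega> \<in> space M. (\<lambda>i. walk X (i + j) \<omega> - walk X j \<omega>) \<in> C}"
      unfolding path_law_def
      by (subst measure_distr) (auto intro!: path_measurable C simp: vimage_def Int_def conj_commute)
    then show ?thesis by (simp only: shifted_walk_law)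
  qed
  also have "prob {\<omega> \<in> space M. X j \<omega> \<in> B} = prob {\<omega> \<in> space M. X 1 \<omega> \<in> B}"
    by (rule prob_step[OF j B])
  also have "{\<omega> \<in> space M. (\<lambda>i\<in>{..<j}. walk X i \<omega>) \<in> A} \<inter> {\<omega> \<in> space M. X j \<omega> \<in> B} \<inter>
      {\<omega> \<in> space M. (\<lambda>i. walk X (i + j) \<omega> - walk X j \<omega>) \<in> C} = {\<omega> \<in> space M. segments (walk X) j \<omega> \<in> A \<times> B \<times> C}"
  proof -
    have "walk X j \<omega> - walk X (j - 1) \<omega> = X j \<omega>" for \<omega>
      using j by (cases j) (auto simp: walk_def One_nat_def)
    then show ?thesis by auto
  qed
  finally show ?thesis .
qed

end

lemma path_law_prob_space:
  assumes "prob_space P" and "\<And>i. Y i \<in> borel_measurable P"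
  shows "prob_space (path_law P Y)"
  unfolding path_law_def using assms by (intro prob_space.prob_space_distr path_measurable)

lemma measure_path_law:
  assumes "\<And>i. Y i \<in> borel_measurable P" "A \<in> sets borel"
  shows "measure (path_law P Y) A = measure P {\<omega> \<in> space P. (\<lambda>i. Y i \<omega>) \<in> A}"
  unfolding path_law_def
  by (subst measure_distr) (auto intro!: path_measurable assms simp: vimage_def Int_def conj_commute)

section \<open>The law of the big-jump process as a mixture over jump events\<close>

context drift_walk
begin

lemma measure_conditioned:
  assumes "E \<in> events" "prob E > 0" "F \<in> events"
  shows "measure (uniform_measure M E) F = prob (E \<inter> F) / prob E"
  using assms by (subst measure_uniform_measure) (auto simp: emeasure_eq_measure)

lemma prob_space_conditioned:
  assumes "E \<in> events" "prob E > 0"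
  shows "prob_space (uniform_measure M E)"
  using assms by (intro prob_space_uniform_measure) (auto simp: emeasure_eq_measure)

lemma prob_jump_pos: "1 \<le> j \<Longrightarrow> prob (jump n j) > 0"
  by (simp add: prob_jump surv_pos tail.tail_pos)

text \<open>The event \<open>jump n j\<close> constrains prefix and jump separately, so conditioning
  on it preserves independence and produces exactly the three laws prescribed for \<open>Z\<close>
  given \<open>I = j\<close>.\<close>

lemma jump_segments_prob:
  assumes j: "1 \<le> j" and A: "A \<in> sets (prefix_space j)" and B: "B \<in> sets borel" and C: "C \<in> sets borel"
  shows "measure (uniform_measure M (jump n j)) {\<omega> \<in> space M. segments (walk X) j \<omega> \<in> A \<times> B \<times> C} =
    measure (prefix_law (uniform_measure M (surv j)) (walk X) j) A *
    measure (distr (uniform_measure M {\<omega> \<in> space M. \<gamma> * real n \<le> X 1 \<omega>}) borel (X 1)) B *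
    measure (path_law M (walk X)) C"
proof -
  \<comment> \<open>Conditioning amounts to shrinking the first two sides of the box: nonnegativity
    for the prefix, the threshold for the jump.\<close>
  let ?A = "A \<inter> {u \<in> space (prefix_space j). \<forall>k\<in>{1..<j}. 0 \<le> u k}" and ?B = "B \<inter> {\<gamma> * real n..}"
  let ?g = "{\<omega> \<in> space M. \<gamma> * real n \<le> X 1 \<omega>}"
  let ?pre = "\<lambda>\<omega>. \<lambda>i\<in>{..<j}. walk X i \<omega>"
  have pre [measurable]: "?pre \<in> measurable M (prefix_space j)"
    by (intro measurable_restrict) auto
  have "{u \<in> space (prefix_space j). 0 \<le> u k} \<in> sets (prefix_space j)" if "k \<in> {1..<j}" for k
  proof -
    have [measurable]: "(\<lambda>u. u k) \<in> borel_measurable (prefix_space j)"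
      by (rule measurable_component_singleton) (use that in auto)
    show ?thesis by measurable
  qed
  then have A': "?A \<in> sets (prefix_space j)"
    using A by (intro sets.Int sets.sets_Collect_finite_All) auto
  have seg: "segments (walk X) j \<in> measurable M (prefix_space j \<Otimes>\<^sub>M (borel \<Otimes>\<^sub>M borel))"
    by (rule segments_measurable) auto
  have ev: "{\<omega> \<in> space M. segments (walk X) j \<omega> \<in> A \<times> B \<times> C} \<in> events"
    using measurable_sets[OF seg, of "A \<times> B \<times> C"] A B C by (simp add: vimage_def Int_def conj_commute)
  have step: "walk X j \<omega> - walk X (j - 1) \<omega> = X j \<omega>" for \<omega>
    using j by (cases j) (auto simp: walk_def One_nat_def)
  have "jump n j \<inter> {\<omega> \<in> space M. segments (walk X) j \<omega> \<in> A \<times> B \<times> C} =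
      {\<omega> \<in> space M. segments (walk X) j \<omega> \<in> ?A \<times> ?B \<times> C}"
    using step by (auto simp: jump_def surv_eq space_PiM)
  then have "measure (uniform_measure M (jump n j)) {\<omega> \<in> space M. segments (walk X) j \<omega> \<in> A \<times> B \<times> C} =
      prob {\<omega> \<in> space M. ?pre \<omega> \<in> ?A} * prob {\<omega> \<in> space M. X 1 \<omega> \<in> ?B} *
      measure (path_law M (walk X)) C / (prob (surv j) * tail (\<gamma> * real n))"
    using measure_conditioned[OF jump_events[OF j] prob_jump_pos[OF j] ev] walk_segments_prob[OF j A' _ C, of ?B] B
    by (simp only: prob_jump[OF j]) auto
  also have "{\<omega> \<in> space M. ?pre \<omega> \<in> ?A} = surv j \<inter> {\<omega> \<in> space M. ?pre \<omega> \<in> A}"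
    by (auto simp: surv_eq space_PiM)
  also have "{\<omega> \<in> space M. X 1 \<omega> \<in> ?B} = ?g \<inter> {\<omega> \<in> space M. X 1 \<omega> \<in> B}"
    by auto
  finally have *: "measure (uniform_measure M (jump n j)) {\<omega> \<in> space M. segments (walk X) j \<omega> \<in> A \<times> B \<times> C} =
      prob (surv j \<inter> {\<omega> \<in> space M. ?pre \<omega> \<in> A}) * prob (?g \<inter> {\<omega> \<in> space M. X 1 \<omega> \<in> B}) *
      measure (path_law M (walk X)) C / (prob (surv j) * tail (\<gamma> * real n))" .
  have "measure (prefix_law (uniform_measure M (surv j)) (walk X) j) A =
      prob (surv j \<inter> {\<omega> \<in> space M. ?pre \<omega> \<in> A}) / prob (surv j)"
  proof -
    have "measure (prefix_law (uniform_measure M (surv j)) (walk X) j) A =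
        measure (uniform_measure M (surv j)) {\<omega> \<in> space M. ?pre \<omega> \<in> A}"
      unfolding prefix_law_def using A by (subst measure_distr) (auto simp: vimage_def Int_def conj_commute)
    also have "\<dots> = prob (surv j \<inter> {\<omega> \<in> space M. ?pre \<omega> \<in> A}) / prob (surv j)"
      by (rule measure_conditioned) (use A in \<open>auto simp: surv_pos\<close>)
    finally show ?thesis .
  qed
  moreover have "measure (distr (uniform_measure M ?g) borel (X 1)) B =
      prob (?g \<inter> {\<omega> \<in> space M. X 1 \<omega> \<in> B}) / tail (\<gamma> * real n)"
  proof -
    have "measure (distr (uniform_measure M ?g) borel (X 1)) B =
        measure (uniform_measure M ?g) {\<omega> \<in> space M. X 1 \<omega> \<in> B}"
      using B by (subst measure_distr) (auto simp: vimage_def Int_def conj_commute)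
    also have "\<dots> = prob (?g \<inter> {\<omega> \<in> space M. X 1 \<omega> \<in> B}) / prob ?g"
      by (rule measure_conditioned) (use B tail.tail_pos[of "\<gamma> * real n"] in \<open>auto simp: tail_def\<close>)
    finally show ?thesis by (simp add: tail_def)
  qed
  ultimately show ?thesis unfolding * by simp
qed

lemma big_jump_processD:
  assumes "big_jump_process M X \<gamma> n N I Z"
  shows "prob_space N" "I \<in> measurable N (count_space UNIV)" "\<And>i. Z i \<in> borel_measurable N"
    and "1 \<le> j \<Longrightarrow> measure N {\<omega> \<in> space N. I \<omega> = j} = prob (surv j) / mean_zeta"
    and "1 \<le> j \<Longrightarrow> indep_three (uniform_measure N {\<omega> \<in> space N. I \<omega> = j}) (prefix_space j) (\<lambda>\<omega>. \<lambda>i\<in>{..<j}. Z i \<omega>)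
      borel (\<lambda>\<omega>. Z j \<omega> - Z (j - 1) \<omega>) borel (\<lambda>\<omega> i. Z (i + j) \<omega> - Z j \<omega>)"
    and "1 \<le> j \<Longrightarrow> prefix_law (uniform_measure N {\<omega> \<in> space N. I \<omega> = j}) Z j
      = prefix_law (uniform_measure M (surv j)) (walk X) j"
    and "1 \<le> j \<Longrightarrow> distr (uniform_measure N {\<omega> \<in> space N. I \<omega> = j}) borel (\<lambda>\<omega>. Z j \<omega> - Z (j - 1) \<omega>)
      = distr (uniform_measure M {\<omega> \<in> space M. \<gamma> * real n \<le> X 1 \<omega>}) borel (X 1)"
    and "1 \<le> j \<Longrightarrow> path_law (uniform_measure N {\<omega> \<in> space N. I \<omega> = j}) (\<lambda>i \<omega>. Z (i + j) \<omega> - Z j \<omega>) = path_law M (walk X)"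
  using assms unfolding big_jump_process_def Let_def surv_def mean_zeta_def by blast+

text \<open>If \<open>E \<zeta> = \<infinity>\<close>, then \<open>enn2real\<close> yields the value \<open>0\<close> and the definition forces \<open>P(I = 1) = 0\<close>;
  conditioning on this event gives the zero measure, which is not the law of the walk.\<close>

lemma expected_zeta_finite:
  assumes bj: "big_jump_process M X \<gamma> n N I Z"
  shows "expected_zeta M X < \<infinity>"
proof (rule ccontr)
  note D = big_jump_processD[OF bj]
  interpret N: prob_space N by (rule D(1))
  note [measurable] = D(2,3)
  let ?J = "{\<omega> \<in> space N. I \<omega> = 1}"
  assume "\<not> expected_zeta M X < \<infinity>"
  then have "mean_zeta = 0" by (simp add: mean_zeta_def less_top[symmetric])
  then have "emeasure N ?J = 0" using D(4)[of 1] by (simp add: N.emeasure_eq_measure)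
  then have "emeasure (uniform_measure N ?J) (space N) = 0"
    by (subst emeasure_uniform_measure) (auto simp: Int_absorb2)
  then have "emeasure (path_law (uniform_measure N ?J) (\<lambda>i \<omega>. Z (i + 1) \<omega> - Z 1 \<omega>)) UNIV = 0"
    unfolding path_law_def by (subst emeasure_distr) (auto intro!: path_measurable)
  moreover interpret W: prob_space "path_law M (walk X)"
    by (rule path_law_prob_space) (auto intro: prob_space_axioms)
  have "emeasure (path_law M (walk X)) UNIV = 1"
    using W.emeasure_space_1 by (simp add: path_law_def)
  ultimately show False using D(8)[of 1] by simp
qed

text \<open>Both sides give every box of segments the same product of three factors, so the path
  laws agree.\<close>

lemma path_law_given_index:
  assumes bj: "big_jump_process M X \<gamma> n N I Z" and j: "1 \<le> j"
  shows "path_law (uniform_measure N {\<omega> \<in> space N. I \<omega> = j}) Z = path_law (uniform_measure M (jump n j)) (walk X)"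
proof -
  note D = big_jump_processD[OF bj]
  interpret N: prob_space N by (rule D(1))
  note [measurable] = D(2,3)
  let ?J = "{\<omega> \<in> space N. I \<omega> = j}"
  have "mean_zeta > 0" using mean_zeta_ge_1[OF expected_zeta_finite[OF bj]] by simp
  then have J: "measure N ?J > 0" using D(4)[OF j] surv_pos by simp
  have P: "prob_space (uniform_measure N ?J)"
    using J by (intro prob_space_uniform_measure) (auto simp: N.emeasure_eq_measure)
  show ?thesis
  proof (rule path_law_eqI[OF j P prob_space_conditioned[OF jump_events[OF j] prob_jump_pos[OF j]]])
    fix A B C assume ABC: "A \<in> sets (prefix_space j)" "B \<in> sets (borel :: real measure)" "C \<in> sets (borel :: (nat \<Rightarrow> real) measure)"
    show "measure (uniform_measure N ?J) {\<omega> \<in> space (uniform_measure N ?J). segments Z j \<omega> \<in> A \<times> B \<times> C} =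
        measure (uniform_measure M (jump n j)) {\<omega> \<in> space (uniform_measure M (jump n j)). segments (walk X) j \<omega> \<in> A \<times> B \<times> C}"
      using indep_three_prob[OF P D(5)[OF j] ABC] jump_segments_prob[OF j ABC, of n]
        D(6)[OF j, unfolded prefix_law_def] D(7)[OF j] D(8)[OF j, unfolded path_law_def]
      by (simp add: prefix_law_def path_law_def)
  qed auto
qed

text \<open>Total probability over \<open>I\<close>: the factor \<open>prob (surv j)\<close> in the
  weight of \<open>j\<close> cancels against that in \<open>prob (jump n j)\<close>, leaving one
  normalising constant for all \<open>j\<close>.\<close>

lemma measure_big_jump_path_law:
  assumes bj: "big_jump_process M X \<gamma> n N I Z" and A: "A \<in> sets borel"
  shows "measure (path_law N Z) A =
    (\<Sum>j. prob ({\<omega> \<in> space M. (\<lambda>i. walk X i \<omega>) \<in> A} \<inter> jump n (Suc j))) / (mean_zeta * tail (\<gamma> * real n))"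
proof -
  note D = big_jump_processD[OF bj]
  interpret N: prob_space N by (rule D(1))
  note [measurable] = D(2,3)
  have fin: "expected_zeta M X < \<infinity>" by (rule expected_zeta_finite[OF bj])
  have a: "mean_zeta > 0" using mean_zeta_ge_1[OF fin] by simp
  let ?J = "\<lambda>j. {\<omega> \<in> space N. I \<omega> = j}"
  let ?E = "{\<omega> \<in> space M. (\<lambda>i. walk X i \<omega>) \<in> A}" and ?F = "{\<omega> \<in> space N. (\<lambda>i. Z i \<omega>) \<in> A}"
  have [measurable]: "(\<lambda>\<omega> i. Z i \<omega>) \<in> borel_measurable N" "(\<lambda>\<omega> i. walk X i \<omega>) \<in> borel_measurable M"
    by (auto intro!: path_measurable)
  have EF [measurable]: "?F \<in> N.events" "?E \<in> events" using A by measurable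
  have split: "(\<lambda>j. N.prob (G \<inter> ?J j)) sums N.prob G" if G: "G \<in> N.events" for G
  proof -
    have "(\<lambda>j. N.prob (G \<inter> ?J j)) sums N.prob (\<Union>j. G \<inter> ?J j)"
      using G by (intro N.finite_measure_UNION) (auto simp: disjoint_family_on_def)
    also have "(\<Union>j. G \<inter> ?J j) = G" using sets.sets_into_space[OF G] by auto
    finally show ?thesis .
  qed
  have "(\<lambda>j. N.prob (?J j)) sums 1"
    using split[OF sets.top] by (simp add: N.prob_space Int_absorb1 Collect_subset)
  then have "(\<lambda>j. N.prob (?J (Suc j))) sums (1 - N.prob (?J 0))"
    using sums_Suc_iff[of "\<lambda>j. N.prob (?J j)" "1 - N.prob (?J 0)"] by simp
  moreover have "(\<lambda>j. N.prob (?J (Suc j))) sums 1"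
    using sums_divide[OF surv_sums[OF fin], of mean_zeta] D(4) a by (simp add: One_nat_def)
  \<comment> \<open>The prescribed masses at positive indices already sum to \<open>1\<close>, which
    excludes the value \<open>0\<close> almost surely.\<close>
  ultimately have J0: "N.prob (?J 0) = 0" using sums_unique2 by fastforce
  have "N.prob (?F \<inter> ?J 0) \<le> N.prob (?J 0)"
    by (rule N.finite_measure_mono) auto
  then have F0: "N.prob (?F \<inter> ?J 0) = 0" using J0 by (simp add: measure_le_0_iff)
  have "(\<lambda>j. N.prob (?F \<inter> ?J (Suc j))) sums N.prob ?F"
    using split[OF EF(1)] F0 sums_Suc_iff[of "\<lambda>j. N.prob (?F \<inter> ?J j)" "N.prob ?F"] by simp
  moreover have "N.prob (?F \<inter> ?J (Suc j)) = prob (?E \<inter> jump n (Suc j)) / (mean_zeta * tail (\<gamma> * real n))" for j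
  proof -
    have j: "1 \<le> Suc j" by simp
    have J: "N.prob (?J (Suc j)) = prob (surv (Suc j)) / mean_zeta" by (rule D(4)[OF j])
    have pos: "prob (surv (Suc j)) > 0" "tail (\<gamma> * real n) > 0" by (rule surv_pos tail.tail_pos)+
    have "measure (path_law (uniform_measure N (?J (Suc j))) Z) A = N.prob (?J (Suc j) \<inter> ?F) / N.prob (?J (Suc j))"
      using J pos a A by (subst measure_path_law, simp, simp, subst measure_uniform_measure)
        (auto simp: N.emeasure_eq_measure EF)
    moreover have "measure (path_law (uniform_measure M (jump n (Suc j))) (walk X)) A =
        prob (jump n (Suc j) \<inter> ?E) / (prob (surv (Suc j)) * tail (\<gamma> * real n))"
      using A measure_conditioned[OF jump_events[OF j] prob_jump_pos[OF j] EF(2)]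
      by (subst measure_path_law) (auto simp: prob_jump[OF j])
    ultimately have "N.prob (?J (Suc j) \<inter> ?F) / N.prob (?J (Suc j)) =
        prob (jump n (Suc j) \<inter> ?E) / (prob (surv (Suc j)) * tail (\<gamma> * real n))"
      using path_law_given_index[OF bj j] by simp
    then have "N.prob (?J (Suc j) \<inter> ?F) = prob (jump n (Suc j) \<inter> ?E) / (mean_zeta * tail (\<gamma> * real n))"
      using J pos a by (simp add: field_simps)
    then show ?thesis by (simp only: Int_commute)
  qed
  ultimately have "(\<lambda>j. prob (?E \<inter> jump n (Suc j)) / (mean_zeta * tail (\<gamma> * real n))) sums N.prob ?F" by simp
  then have "N.prob ?F = (\<Sum>j. prob (?E \<inter> jump n (Suc j)) / (mean_zeta * tail (\<gamma> * real n)))"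
    by (rule sums_unique)
  also have "\<dots> = (\<Sum>j. prob (?E \<inter> jump n (Suc j))) / (mean_zeta * tail (\<gamma> * real n))"
    by (rule suminf_divide[OF summable_prob_jump[OF fin EF(2)]])
  finally show ?thesis using A by (subst measure_path_law) auto
qed

end

text \<open>A one-sided estimate suffices, since it can be applied to the complement of a set as well.\<close>

lemma tv_dist_le:
  assumes P: "prob_space P" and Q: "prob_space Q" and sets: "sets P = sets Q"
    and le: "\<And>A. A \<in> sets P \<Longrightarrow> measure Q A \<le> measure P A + \<epsilon>"
  shows "\<bar>tv_dist P Q\<bar> \<le> \<epsilon>"
proof -
  interpret P: prob_space P by fact
  interpret Q: prob_space Q by fact
  have sp: "space P = space Q" by (rule sets_eq_imp_space_eq[OF sets])
  have abs: "\<bar>measure P A - measure Q A\<bar> \<le> \<epsilon>" if A: "A \<in> sets P" for A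
  proof -
    have "measure Q (space P - A) \<le> measure P (space P - A) + \<epsilon>"
      using A by (intro le) auto
    then have "1 - measure Q A \<le> 1 - measure P A + \<epsilon>"
      using A P.prob_compl[OF A] Q.prob_compl[of A] sets sp by simp
    with le[OF A] show ?thesis by linarith
  qed
  have "tv_dist P Q \<le> \<epsilon>"
    unfolding tv_dist_def by (rule cSUP_least) (use abs in auto)
  \<comment> \<open>The empty set makes the supremum nonnegative; the uniform bound supplies the
    boundedness needed for a real supremum.\<close>
  moreover have "\<bar>measure P {} - measure Q {}\<bar> \<le> tv_dist P Q"
    unfolding tv_dist_def by (rule cSUP_upper) (use abs in \<open>auto intro!: bdd_aboveI2\<close>)
  ultimately show ?thesis by simp
qed

theorem theorem7:
  fixes M :: "'a measure" and X :: "nat \<Rightarrow> 'a \<Rightarrow> real" and L :: "real \<Rightarrow> real"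
    and \<gamma> \<beta> :: real
    and N :: "nat \<Rightarrow> 'b measure" and I :: "nat \<Rightarrow> 'b \<Rightarrow> nat" and Z :: "nat \<Rightarrow> nat \<Rightarrow> 'b \<Rightarrow> real"
  assumes "prob_space M"
    and "prob_space.indep_vars M (\<lambda>_. borel) X {1..}"
    and "\<And>i. i \<ge> 1 \<Longrightarrow> distr M borel (X i) = distr M borel (X 1)"
    and "integrable M (X 1)"
    and "(\<integral>\<omega>. X 1 \<omega> \<partial>M) = - \<gamma>" and "\<gamma> > 0"
    and "\<beta> > 1" and "slowly_varying L"
    and "\<And>x. x > 0 \<Longrightarrow> measure M {\<omega> \<in> space M. X 1 \<omega> \<ge> x} = L x * x powr (- \<beta>)"
    and "\<And>n. n \<ge> 1 \<Longrightarrow> big_jump_process M X \<gamma> n (N n) (I n) (Z n)"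
  shows "(\<lambda>n. tv_dist
            (path_law (uniform_measure M {\<omega> \<in> space M. zeta X \<omega> \<ge> enat n}) (walk X))
            (path_law (N n) (Z n))) \<longlonglongrightarrow> 0"
proof -
  interpret drift_walk M X L \<gamma> \<beta>
    by (intro drift_walk.intro drift_walk_axioms.intro assms)
  note bj = assms(10)
  \<comment> \<open>The process for a single \<open>n\<close> already forces a finite
    expectation.\<close>
  have fin: "expected_zeta M X < \<infinity>" using bj[of 1] by (intro expected_zeta_finite) simp
  have "\<forall>\<^sub>F n in sequentially. \<bar>tv_dist (path_law (uniform_measure M (surv n)) (walk X)) (path_law (N n) (Z n))\<bar> \<le> \<epsilon>"
    if \<epsilon>: "\<epsilon> > 0" for \<epsilon>
    using jump_mixture_le[OF fin \<epsilon>] eventually_ge_at_top[of 1]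
  proof eventually_elim
    case (elim n)
    note D = big_jump_processD[OF bj[OF elim(2)]]
    show ?case
    proof (rule tv_dist_le)
      show "prob_space (path_law (uniform_measure M (surv n)) (walk X))"
        by (intro path_law_prob_space prob_space_conditioned surv_pos) auto
      show "prob_space (path_law (N n) (Z n))"
        by (intro path_law_prob_space D)
      show "sets (path_law (uniform_measure M (surv n)) (walk X)) = sets (path_law (N n) (Z n))"
        by (simp add: path_law_def)
      fix A assume "A \<in> sets (path_law (uniform_measure M (surv n)) (walk X))"
      then have A: "A \<in> sets borel" by (simp add: path_law_def)
      let ?E = "{\<omega> \<in> space M. (\<lambda>i. walk X i \<omega>) \<in> A}"
      have "(\<lambda>\<omega> i. walk X i \<omega>) \<in> borel_measurable M" by (auto intro!: path_measurable)
      from measurable_sets[OF this A] have E: "?E \<in> events"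
        by (simp add: vimage_def Int_def conj_commute)
      have "measure (path_law (uniform_measure M (surv n)) (walk X)) A = prob (?E \<inter> surv n) / prob (surv n)"
        using A measure_conditioned[OF surv_measurable surv_pos E]
        by (subst measure_path_law) (auto simp: Int_commute)
      \<comment> \<open>The eventual bound holds for all events simultaneously, so the same
        \<open>n\<close> serves every Borel set \<open>A\<close> of paths.\<close>
      with bspec[OF elim(1) E] show "measure (path_law (N n) (Z n)) A \<le> measure (path_law (uniform_measure M (surv n)) (walk X)) A + \<epsilon>"
        by (simp only: measure_big_jump_path_law[OF bj[OF elim(2)] A])
    qed
  qed
  then have "(\<lambda>n. tv_dist (path_law (uniform_measure M (surv n)) (walk X)) (path_law (N n) (Z n))) \<longlonglongrightarrow> 0"
  proof (intro tendstoI)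
    fix e :: real assume e: "0 < e" "\<And>\<epsilon>. 0 < \<epsilon> \<Longrightarrow> \<forall>\<^sub>F n in sequentially.
      \<bar>tv_dist (path_law (uniform_measure M (surv n)) (walk X)) (path_law (N n) (Z n))\<bar> \<le> \<epsilon>"
    from e(2)[of "e / 2"] e(1)
    show "\<forall>\<^sub>F n in sequentially.
      dist (tv_dist (path_law (uniform_measure M (surv n)) (walk X)) (path_law (N n) (Z n))) 0 < e"
      by (auto elim: eventually_mono)
  qed
  then show ?thesis by (simp add: surv_def)
qed

end
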